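(* Let $S_{\rm loc}=\int d^Dx\,\sqrt{|g|}\,\mathcal L_{\rm loc}$, with $\mathcal L_{\rm loc}=\frac{1}{2\kappa^2}R+\mathcal L_{\rm m}$, be the local theory of Einstein gravity (Ricci scalar $R$) coupled to matter with Lagrangian $\mathcal L_{\rm m}$, in $D$ spacetime dimensions, with fields $\Phi_i$ (metric and matter fields). Let $E_i=\delta S_{\rm loc}/\delta\Phi_i$ and $\Delta_{ki}=\delta E_i/\delta\Phi_k=\delta^2S_{\rm loc}/\delta\Phi_k\delta\Phi_i$. Let $S$ be the nonlocal theory with action $$S(\Phi_i)=\int d^Dx\,\sqrt{|g|}\,\left[\mathcal L_{\rm loc}+E_i\,F_{ij}(\Delta)\,E_j+\mathcal V(E)\right],$$ where $\mathcal V(E)=O(E^3)$ is at least cubic in the $E_i$, and where $F_{ij}(\Delta)$ is the form factor determined by an entire function $H$ through $$2\,\Delta_{ik}F_{kj}(\Delta)=\left[e^{H(\Delta)}-1\right]_{ij},$$ with $e^{H}=1$ on the mass shell. Then all the on-shell $n$-point tree-level scattering amplitudes of the theory $S$ on Minkowski spacetime are the same as the on-shell $n$-point tree-level scattering amplitudes of the local theory $S_{\rm loc}$: for every $n\ge 3$, all field labels $i_1,\dots,i_n$ and all on-shell momenta $p_1,\dots,p_n$, $$\mathcal A^{i_1\dots i_n}_{n}(p_1,\dots,p_n)\big|_{S}=\mathcal A^{i_1\dots i_n}_{n}(p_1,\dots,p_n)\big|_{S_{\rm loc}}.$$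
   Context: **Notation.** The metric signature is $(-,+,\dots,+)$. Here $\kappa^2=8\pi G$ with $G$ Newton's constant, and $g$ is the determinant of the metric. Compact DeWitt notation is used: the index $i$ on a field $\Phi_i$ ($=g_{\mu\nu},A_\mu,\phi,\dots$) encodes Lorentz indices, group indices and the spacetime point. Repeated indices are summed (and integrated) over. Field space is flat, so index position is immaterial. The objects $E_i$ are the local equations of motion (EoM), meaning that the local EoM are $E_i=0$. The operator $\Delta$ is the Hessian of the local action. **Form factors.** $H$ is an entire function, and the form factor $F(z)=\frac{e^{H(z)}-1}{2z}$ is also entire. By construction, $e^{H}$ evaluated on the background equals $1$ on the mass shell $k^2=-m^2$ of each particle (at $k^2=0$ for massless particles such as the graviton). **Background and perturbative solutions.** The theory is expanded around the Minkowski background, which solves the local EoM $E_i=0$. For either theory, the classical EoM is solved perturbatively, with fluctuations around the background written as $\sum_{m\ge 0}\Phi_i^{(m)}$. Here $\Phi_i^{(m)}$ is of order $m$ in the small expansion parameter (e.g. the coupling). The term $\Phi_i^{(0)}$ solves the linearized (free) EoM. The terms $\Phi_i^{(m)}$, $m\ge 1$, are determined recursively by the EoM as functionals of $\Phi^{(0)}$, homogeneous of degree $m+1$ in $\Phi^{(0)}$. A tilde denotes the Fourier transform, $\Phi(x)=\int\frac{d^Dp}{(2\pi)^D}\,\tilde\Phi(p)\,e^{-ip\cdot x}$. Functional derivatives in momentum space are normalized by $\delta\tilde\Phi(p)/\delta\tilde\Phi(p')=(2\pi)^D\delta^D(p-p')$. **Tree-level amplitudes.** The on-shell $n$-point tree-level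 scattering amplitude of a theory is $$\mathcal A^{i_1\dots i_n}_n(p_1,\dots,p_n)=\lim_{p_n^2\to -m_n^2}\frac{1}{i\,\tilde G(p_n)}\,\frac{\delta^{n-1}\tilde\Phi^{(n-2)}_{i_n}(-p_n)}{\delta\tilde\Phi^{(0)}_{i_1}(p_1)\cdots\delta\tilde\Phi^{(0)}_{i_{n-1}}(p_{n-1})},$$ where $m_n$ is the mass of the $n$-th particle, $\tilde G$ is the tree-level two-point Green's function of the theory ($i\tilde G$ is the propagator), and the momenta $p_1,\dots,p_{n-1}$ are on shell. The Green's function has the form $\tilde G(k)=-1/(k^2+m^2)$ in the local theory and $\tilde G(k)=-e^{-H}/(k^2+m^2)$ in the nonlocal theory, with the tensor structure and gauge fixing understood for fields with indices. *)

theory Defs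
  imports
    "HOL-Complex_Analysis.Complex_Analysis"
    "HOL-Library.Multiset"
    "HOL-Library.Uprod"
    "HOL-Library.Groups_Big_Fun"
begin

text \<open>
  Perturbation theory around Minkowski space is formalised with power series in the Fourier
  amplitudes of the fluctuations. The fluctuation of the field with label \<open>i\<close> is written
  \<open>\<phi>\<^sub>i(x) = (\<Sum>p. \<phi>(i,p) exp(-\<i> p x))\<close>, so a DeWitt index is a pair \<open>(i, p)\<close> of a label (Lorentz and
  group indices) and a covariant momentum, and a functional of the fields is a power series in the
  commuting variables \<open>\<phi>(i,p)\<close>. Functional derivatives are partial derivatives with
  \<open>\<partial>\<phi>(i,p)/\<partial>\<phi>(j,q) = \<delta>\<^sub>i\<^sub>j \<delta>\<^sub>p\<^sub>q\<close>: each \<open>(2\<pi>)\<^sup>D \<delta>\<^sup>D(p - q)\<close> of the continuum normalisation is a Kronecker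
  delta here, so amplitudes appear with the overall momentum-conservation delta removed.
\<close>

unbundle no fps_syntax

section \<open>Power series in arbitrarily many variables\<close>

typedef 'v mps = "UNIV :: ('v multiset \<Rightarrow> complex) set"
  morphisms mps_coeff Abs_mps ..

setup_lifting type_definition_mps

lemma mps_eqI: "(\<And>M. mps_coeff f M = mps_coeff g M) \<Longrightarrow> f = g"
  by transfer auto

lemma coeff_Abs [simp]: "mps_coeff (Abs_mps f) = f"
  by (simp add: Abs_mps_inverse)

lemma finite_submultisets: "finite {A. A \<subseteq># (M :: 'v multiset)}"
proof (induction M)
  case empty
  then show ?case by simp
next
  case (add x M)
  have "{A. A \<subseteq># add_mset x M} \<subseteq> {A. A \<subseteq># M} \<union> add_mset x ` {A. A \<subseteq># M}"
  proof
    fix A assume "A \<in> {A. A \<subseteq># add_mset x M}"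
    hence A: "A \<subseteq># add_mset x M" by simp
    show "A \<in> {A. A \<subseteq># M} \<union> add_mset x ` {A. A \<subseteq># M}"
    proof (cases "x \<in># A")
      case True
      then obtain B where "A = add_mset x B" by (metis mset_add)
      with A show ?thesis by auto
    next
      case False
      with A show ?thesis
        by (metis UnI1 add_mset_remove_trivial diff_single_trivial mem_Collect_eq
            subset_eq_diff_conv union_mset_add_mset_right add.right_neutral)
    qed
  qed
  with add show ?case by (meson finite_UnI finite_imageI finite_subset)
qed

instantiation mps :: (type) comm_ring_1
begin

lift_definition zero_mps :: "'v mps" is "\<lambda>_. 0" .
lift_definition one_mps :: "'v mps" is "\<lambda>M. if M = {#} then 1 else 0" .
lift_definition plus_mps :: "'v mps \<Rightarrow> 'v mps \<Rightarrow> 'v mps" is "\<lambda>f g M. f M + g M" .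
lift_definition minus_mps :: "'v mps \<Rightarrow> 'v mps \<Rightarrow> 'v mps" is "\<lambda>f g M. f M - g M" .
lift_definition uminus_mps :: "'v mps \<Rightarrow> 'v mps" is "\<lambda>f M. - f M" .
lift_definition times_mps :: "'v mps \<Rightarrow> 'v mps \<Rightarrow> 'v mps"
  is "\<lambda>f g M. \<Sum>A | A \<subseteq># M. f A * g (M - A)" .

instance
proof
  fix f g h :: "'a mps"
  show "f * g * h = f * (g * h)"
  proof (transfer, rule ext)
    fix f g h :: "'a multiset \<Rightarrow> complex" and M
    have "(\<Sum>A | A \<subseteq># M. (\<Sum>B | B \<subseteq># A. f B * g (A - B)) * h (M - A))
        = (\<Sum>(A, B)\<in>Sigma {A. A \<subseteq># M} (\<lambda>A. {B. B \<subseteq># A}). f B * g (A - B) * h (M - A))"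
      by (simp add: sum_distrib_right sum.Sigma finite_submultisets)
    also have "\<dots> = (\<Sum>(B, C)\<in>Sigma {B. B \<subseteq># M} (\<lambda>B. {C. C \<subseteq># M - B}).
                      f B * (g C * h (M - B - C)))"
    proof (rule sum.reindex_bij_witness
        [where j = "\<lambda>(A, B). (B, A - B)" and i = "\<lambda>(B, C). (B + C, B)"])
      fix a assume "a \<in> Sigma {A. A \<subseteq># M} (\<lambda>A. {B. B \<subseteq># A})"
      then obtain B C D where a: "a = (B + C, B)" and M: "M = B + C + D"
        by (auto simp: mset_subset_eq_exists_conv)
      show "(case case a of (A, B) \<Rightarrow> (B, A - B) of (B, C) \<Rightarrow> (B + C, B)) = a"
        by (simp add: a)
      show "(case a of (A, B) \<Rightarrow> (B, A - B)) \<in> Sigma {B. B \<subseteq># M} (\<lambda>B. {C. C \<subseteq># M - B})"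
        by (simp add: a M add.assoc)
      show "(case case a of (A, B) \<Rightarrow> (B, A - B) of (B, C) \<Rightarrow> f B * (g C * h (M - B - C)))
          = (case a of (A, B) \<Rightarrow> f B * g (A - B) * h (M - A))"
        by (simp add: a M add.assoc mult.assoc)
    next
      fix b assume "b \<in> Sigma {B. B \<subseteq># M} (\<lambda>B. {C. C \<subseteq># M - B})"
      then obtain B C where b: "b = (B, C)" and "B \<subseteq># M" "C \<subseteq># M - B"
        by auto
      then obtain D where M: "M = B + C + D"
        by (metis add.assoc add_diff_cancel_left' mset_subset_eq_exists_conv)
      show "(case case b of (B, C) \<Rightarrow> (B + C, B) of (A, B) \<Rightarrow> (B, A - B)) = b"
        by (simp add: b)
      show "(case b of (B, C) \<Rightarrow> (B + C, B)) \<in> Sigma {A. A \<subseteq># M} (\<lambda>A. {B. B \<subseteq># A})"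
        by (simp add: b M)
    qed
    also have "\<dots> = (\<Sum>B | B \<subseteq># M. f B * (\<Sum>C | C \<subseteq># M - B. g C * h (M - B - C)))"
      by (simp add: sum_distrib_left sum.Sigma finite_submultisets)
    finally show "(\<Sum>A | A \<subseteq># M. (\<Sum>B | B \<subseteq># A. f B * g (A - B)) * h (M - A))
                = (\<Sum>B | B \<subseteq># M. f B * (\<Sum>C | C \<subseteq># M - B. g C * h (M - B - C)))" .
  qed
  show "f * g = g * f"
  proof (transfer, rule ext)
    fix f g :: "'a multiset \<Rightarrow> complex" and M
    show "(\<Sum>A | A \<subseteq># M. f A * g (M - A)) = (\<Sum>A | A \<subseteq># M. g A * f (M - A))"
      by (rule sum.reindex_bij_witness[where i = "\<lambda>A. M - A" and j = "\<lambda>A. M - A"])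
         (auto simp: mset_subset_eq_exists_conv mult.commute)
  qed
  show "1 * f = f"
  proof (transfer, rule ext)
    fix f :: "'a multiset \<Rightarrow> complex" and M
    have "(\<Sum>A | A \<subseteq># M. (if A = {#} then 1 else 0) * f (M - A))
        = (\<Sum>A | A \<subseteq># M. if A = {#} then f M else 0)"
      by (rule sum.cong) auto
    also have "\<dots> = f M" by (simp add: finite_submultisets)
    finally show "(\<Sum>A | A \<subseteq># M. (if A = {#} then 1 else 0) * f (M - A)) = f M" .
  qed
  show "(f + g) * h = f * h + g * h"
    by transfer (simp add: distrib_right sum.distrib)
  show "(0 :: 'a mps) \<noteq> 1"
    by transfer (metis zero_neq_one)
qed (transfer; force simp: algebra_simps)+

end

definition mps_const :: "complex \<Rightarrow> 'v mps" where
  "mps_const c = Abs_mps (\<lambda>M. if M = {#} then c else 0)"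

definition mps_deriv :: "'v \<Rightarrow> 'v mps \<Rightarrow> 'v mps" where
  "mps_deriv v f = Abs_mps (\<lambda>M. of_nat (count M v + 1) * mps_coeff f (add_mset v M))"

text \<open>
  Coefficientwise sum of a family of which only finitely many members contribute to each
  coefficient. All sums over DeWitt indices below are of this kind, by momentum conservation.
\<close>

definition mps_Sum :: "('k \<Rightarrow> 'v mps) \<Rightarrow> 'v mps" where
  "mps_Sum f = Abs_mps (\<lambda>M. Sum_any (\<lambda>k. mps_coeff (f k) M))"

definition mps_subst :: "'v mps \<Rightarrow> ('v \<Rightarrow> 'w mps) \<Rightarrow> 'w mps" where
  "mps_subst f \<Phi> = mps_Sum (\<lambda>N. mps_const (mps_coeff f N) * (\<Prod>a\<in>#N. \<Phi> a))"

text \<open>Square roots and matrix inverses of power series exist under a condition on the constant terms.\<close>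

lemma mps_coeff_simps [simp]:
  "mps_coeff 0 M = 0" "mps_coeff 1 M = (if M = {#} then 1 else 0)"
  "mps_coeff (f + g) M = mps_coeff f M + mps_coeff g M"
  "mps_coeff (f - g) M = mps_coeff f M - mps_coeff g M"
  "mps_coeff (- f) M = - mps_coeff f M"
  "mps_coeff (mps_const c) M = (if M = {#} then c else 0)"
  by (transfer; simp; fail)+ (simp add: mps_const_def)

lemma mps_coeff_mult: "mps_coeff (f * g) M = (\<Sum>A | A \<subseteq># M. mps_coeff f A * mps_coeff g (M - A))"
  by transfer simp

lemma mps_const_mult: "mps_const a * mps_const b = mps_const (a * b)"
proof (rule mps_eqI)
  fix M show "mps_coeff (mps_const a * mps_const b) M = mps_coeff (mps_const (a * b)) M"
    by (cases "M = {#}") (auto simp: mps_coeff_mult intro!: sum.neutral)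
qed

lemma mps_coeff_sum [simp]: "mps_coeff (sum f S) M = (\<Sum>x\<in>S. mps_coeff (f x) M)"
  by (induction S rule: infinite_finite_induct) auto

lemma mps_coeff_mult_0 [simp]: "mps_coeff (f * g) {#} = mps_coeff f {#} * mps_coeff g {#}"
  by (simp add: mps_coeff_mult)

definition mps_order_ge :: "nat \<Rightarrow> 'v mps \<Rightarrow> bool" where
  "mps_order_ge n f \<longleftrightarrow> (\<forall>M. size M < n \<longrightarrow> mps_coeff f M = 0)"

lemma mps_order_ge_mult: assumes "mps_order_ge a f" "mps_order_ge b g" shows "mps_order_ge (a + b) (f * g)"
  unfolding mps_order_ge_def mps_coeff_mult
proof (intro allI impI sum.neutral ballI)
  fix M A :: "'a multiset" assume "size M < a + b" "A \<in> {A. A \<subseteq># M}"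
  hence "size A < a \<or> size (M - A) < b" 
    by (auto simp: size_Diff_submset dest: size_mset_mono)
  thus "mps_coeff f A * mps_coeff g (M - A) = 0" using assms by (auto simp: mps_order_ge_def)
qed

lemma mps_order_ge_add: "mps_order_ge n f \<Longrightarrow> mps_order_ge n g \<Longrightarrow> mps_order_ge n (f + g)" by (simp add: mps_order_ge_def)
lemma mps_order_ge_sum: "(\<And>x. x \<in> S \<Longrightarrow> mps_order_ge n (f x)) \<Longrightarrow> mps_order_ge n (sum f S)" by (simp add: mps_order_ge_def)
lemma mps_order_ge_0: "mps_order_ge 0 f" by (simp add: mps_order_ge_def)
lemma mps_order_ge_1: "mps_order_ge (Suc 0) f \<longleftrightarrow> mps_coeff f {#} = 0" by (simp add: mps_order_ge_def)

lemma mps_order_ge_agree: assumes "mps_order_ge (Suc n) (f - f')" "size M \<le> n" shows "mps_coeff f M = mps_coeff f' M"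
  using assms by (auto simp: mps_order_ge_def)

lemma mps_limit_exists:
  assumes "\<And>n. mps_order_ge (Suc n) (s (Suc n) - s n)"
  obtains l where "\<And>n. mps_order_ge (Suc n) (l - s n)"
proof
  fix n
  have step: "mps_coeff (s (n + k)) M = mps_coeff (s n) M" if "size M \<le> n" for n k M
  proof (induction k)
    case (Suc k)
    have "mps_coeff (s (Suc (n + k))) M = mps_coeff (s (n + k)) M"
      by (rule mps_order_ge_agree[OF assms]) (use that in simp)
    with Suc show ?case by simp
  qed simp
  show "mps_order_ge (Suc n) (Abs_mps (\<lambda>M. mps_coeff (s (size M)) M) - s n)"
    unfolding mps_order_ge_def
  proof (intro allI impI)
    fix M :: "'a multiset" assume "size M < Suc n"
    thus "mps_coeff (Abs_mps (\<lambda>M. mps_coeff (s (size M)) M) - s n) M = 0"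
      using step[of M "size M" "n - size M"] by simp
  qed
qed

lemma mps_zeroI: "(\<And>n. mps_order_ge (Suc n) f) \<Longrightarrow> f = 0"
  by (rule mps_eqI) (auto simp: mps_order_ge_def)

lemma mps_sqrt_exists:
  assumes "mps_coeff f {#} = 1"
  shows "\<exists>!s. s * s = f \<and> mps_coeff s {#} = 1"
proof -
  define s where "s = rec_nat 1 (\<lambda>_ s. s + mps_const (1/2) * (f - s * s))"
  have s: "s 0 = 1" "\<And>n. s (Suc n) = s n + mps_const (1/2) * (f - s n * s n)"
    by (simp_all add: s_def)
  have half: "mps_const (1/2) + mps_const (1/2) = (1 :: 'a mps)" by (rule mps_eqI) (simp only: mps_coeff_simps, simp)
  have c1: "mps_coeff (s n) {#} = 1" for n by (induction n) (simp_all add: s assms)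
  have err: "mps_order_ge (Suc n) (f - s n * s n)" for n
  proof (induction n)
    case 0 show ?case using assms by (simp add: mps_order_ge_1 s)
  next
    case (Suc n)
    define e where "e = f - s n * s n"
    define q where "q = (mps_const (1/2) :: 'a mps)"
    have h: "q + q = 1" using half q_def by simp
    have "f - s (Suc n) * s (Suc n) = e - (q + q) * s n * e - q * q * e * e"
      unfolding s e_def[symmetric] q_def[symmetric] by (simp add: e_def algebra_simps)
    also have "\<dots> = (1 - s n - q * q * e) * e" by (simp add: h algebra_simps)
    finally have eq: "f - s (Suc n) * s (Suc n) = (1 - s n - q * q * e) * e" .
    have "mps_order_ge (Suc 0) (1 - s n - q * q * e)" using c1 assms by (simp add: mps_order_ge_1 e_def)
    from mps_order_ge_mult[OF this Suc.IH[folded e_def]] show ?case by (simp add: eq)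
  qed
  obtain l where l: "\<And>n. mps_order_ge (Suc n) (l - s n)"
    by (rule mps_limit_exists[of s]) (use mps_order_ge_mult[OF mps_order_ge_0 err] s in auto)
  have "f - l * l = 0"
  proof (rule mps_zeroI)
    fix n
    have "f - l * l = (f - s n * s n) + (- 1 * (l + s n)) * (l - s n)" by (simp add: algebra_simps)
    moreover have "mps_order_ge (Suc n) (- 1 * (l + s n) * (l - s n))"
      using mps_order_ge_mult[OF mps_order_ge_0 l[of n], of "- 1 * (l + s n)"] by (simp only: add_0)
    ultimately show "mps_order_ge (Suc n) (f - l * l)" using mps_order_ge_add[OF err[of n]] by metis
  qed
  moreover have "mps_coeff l {#} = 1" using mps_order_ge_agree[OF l[of 0]] c1 by simp
  ultimately have ll: "l * l = f \<and> mps_coeff l {#} = 1" by simp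
  have uni: "l' = l" if l': "l' * l' = f \<and> mps_coeff l' {#} = 1" for l'
  proof -
  have "mps_order_ge n (l' - l)" for n
  proof (induction n)
    case (Suc n)
    define q where "q = (mps_const (1/2) :: 'a mps)"
    have h: "q + q = 1" using half q_def by simp
    have "0 = (l' - l) * (l' + l)" using l' \<open>f - l * l = 0\<close> by (simp add: algebra_simps)
    hence "l' - l = (l' - l) * ((q + q) - q * (l' + l))"
      unfolding h by (simp add: algebra_simps) (metis distrib_left mult_zero_right ring_class.ring_distribs(1) add.commute mult.assoc mult.left_commute mult.commute)
    moreover have "mps_order_ge (Suc 0) ((q + q) - q * (l' + l))"
      unfolding h using l' \<open>mps_coeff l {#} = 1\<close> by (simp add: mps_order_ge_1 q_def)
    ultimately show ?case using mps_order_ge_mult[OF Suc] by (metis add_Suc_right add.right_neutral)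
  qed (rule mps_order_ge_0)
  hence "l' - l = 0" by (intro mps_zeroI)
  thus "l' = l" by simp
  qed
  from ll uni show ?thesis by blast
qed

lemma matrix_add_rd: "(A + B) ** C = A ** C + B ** (C :: 'a::comm_ring_1^'n^'n)"
  by (vector matrix_matrix_mult_def sum.distrib[symmetric] field_simps)
lemma matrix_sub_ld: "C ** (A - B) = C ** A - C ** (B :: 'a::comm_ring_1^'n^'n)"
  by (vector matrix_matrix_mult_def sum_subtractf[symmetric] field_simps)
lemma matrix_sub_rd: "(A - B) ** C = A ** C - B ** (C :: 'a::comm_ring_1^'n^'n)"
  by (vector matrix_matrix_mult_def sum_subtractf[symmetric] field_simps)
lemma matrix_neg: "(- A) ** C = - (A ** C)" "C ** - A = - (C ** A)" for A :: "'a::comm_ring_1^'n^'n"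
  by (vector matrix_matrix_mult_def sum_negf)+

lemma mps_matrix_inverse_exists:
  fixes X :: "'v mps ^ 'n ^ 'n"
  assumes X: "\<And>i j. mps_order_ge (Suc 0) (X $ i $ j)"
  shows "\<exists>N. (mat 1 - X) ** N = mat 1 \<and> N ** (mat 1 - X) = mat 1"
proof -
  define s where "s = rec_nat (mat 1) (\<lambda>_ Y. mat 1 + X ** Y)"
  have s: "s 0 = mat 1" "\<And>n. s (Suc n) = mat 1 + X ** s n" by (simp_all add: s_def)
  have comm: "X ** s n = s n ** X" for n
  proof (induction n)
    case (Suc n)
    have "X ** s (Suc n) = X + X ** (s n ** X)" by (simp add: s matrix_add_ldistrib Suc)
    thus ?case by (simp add: s matrix_add_rd matrix_mul_assoc)
  qed (simp add: s)
  have lm: "mps_order_ge (a + b) ((Y ** Z) $ i $ j)"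
    if "\<And>i j. mps_order_ge a (Y $ i $ j)" "\<And>i j. mps_order_ge b (Z $ i $ j)" for a b i j and Y Z :: "'v mps ^ 'n ^ 'n"
    unfolding matrix_matrix_mult_def by (simp add: mps_order_ge_sum mps_order_ge_mult that)
  have st: "mps_order_ge (Suc n) ((s (Suc n) - s n) $ i $ j)" for n i j
  proof (induction n arbitrary: i j)
    case 0
    then show ?case using X by (simp add: s)
  next
    case (Suc n)
    have "s (Suc (Suc n)) - s (Suc n) = X ** (s (Suc n) - s n)"
      unfolding matrix_sub_ld by (simp add: s)
    then show ?case using lm[OF X Suc.IH] by (simp del: s vector_minus_component)
  qed
  have "\<forall>i j. \<exists>l. \<forall>n. mps_order_ge (Suc n) (l - s n $ i $ j)"
  proof (intro allI)
    fix i j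
    show "\<exists>l. \<forall>n. mps_order_ge (Suc n) (l - s n $ i $ j)"
      by (rule mps_limit_exists[of "\<lambda>n. s n $ i $ j"]) (use st in auto)
  qed
  then obtain L where L: "\<And>i j n. mps_order_ge (Suc n) (L i j - s n $ i $ j)" by metis
  define N where "N = (\<chi> i j. L i j)"
  have N: "mps_order_ge (Suc n) ((N - s n) $ i $ j)" for n i j using L by (simp add: N_def)
  have res: "mps_order_ge (Suc n) ((mat 1 - (mat 1 - X) ** s n) $ i $ j)" for n i j
  proof -
    have "mat 1 - (mat 1 - X) ** s n = s (Suc n) - s n"
      by (simp add: s matrix_sub_rd matrix_neg)
    thus ?thesis using st by simp
  qed
  have res': "mps_order_ge (Suc n) ((mat 1 - s n ** (mat 1 - X)) $ i $ j)" for n i j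
  proof -
    have "mat 1 - s n ** (mat 1 - X) = s (Suc n) - s n"
      by (simp add: s comm matrix_sub_ld matrix_neg)
    thus ?thesis using st by simp
  qed
  have 1: "(mat 1 - (mat 1 - X) ** N) $ i $ j = 0" for i j
  proof (rule mps_zeroI)
    fix n
    have e: "mat 1 - (mat 1 - X) ** N = (mat 1 - (mat 1 - X) ** s n) + - (mat 1 - X) ** (N - s n)"
      by (simp add: matrix_sub_ld matrix_neg matrix_sub_rd matrix_neg)
    thus "mps_order_ge (Suc n) ((mat 1 - (mat 1 - X) ** N) $ i $ j)"
      using mps_order_ge_add[OF res[of n] lm[where b="Suc n" and a=0 and Z="N - s n" and Y="- (mat 1 - X)", OF mps_order_ge_0 N, simplified add_0]] unfolding e vector_add_component by blast
  qed
  have 2: "(mat 1 - N ** (mat 1 - X)) $ i $ j = 0" for i j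
  proof (rule mps_zeroI)
    fix n
    have e: "mat 1 - N ** (mat 1 - X) = (mat 1 - s n ** (mat 1 - X)) + (N - s n) ** - (mat 1 - X)"
      by (simp add: matrix_sub_ld matrix_neg matrix_sub_rd matrix_neg)
    thus "mps_order_ge (Suc n) ((mat 1 - N ** (mat 1 - X)) $ i $ j)"
      using mps_order_ge_add[OF res'[of n] lm[where a="Suc n" and b=0 and Y="N - s n" and Z="- (mat 1 - X)", OF N mps_order_ge_0, simplified add_0_right]] unfolding e vector_add_component by blast
  qed
  from 1 2 show ?thesis by (intro exI[of _ N]) (simp add: vec_eq_iff)
qed

section \<open>Densities, actions and local Lagrangians\<close>

text \<open>
  A density \<open>L(x)\<close> built from the fields is represented by its coefficients \<open>L\<^sub>M\<close> in
  \<open>L(x) = (\<Sum>M. L\<^sub>M (\<Prod>(i,p)\<in>M. \<phi>(i,p)) exp(-\<i> P\<^sub>M x))\<close>, where \<open>P\<^sub>M\<close> is the total momentum.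
\<close>

type_synonym ('i, 'd) functional = "('i \<times> (real ^ 'd)) mps"

definition total_momentum :: "('i \<times> (real ^ 'd::finite)) multiset \<Rightarrow> real ^ 'd" where
  "total_momentum M = (\<Sum>a\<in>#M. snd a)"

definition fluctuation :: "'i \<Rightarrow> ('i, 'd::finite) functional" where
  "fluctuation i = Abs_mps (\<lambda>M. if \<exists>p. M = {#(i, p)#} then 1 else 0)"

definition partial :: "'d::finite \<Rightarrow> ('i, 'd) functional \<Rightarrow> ('i, 'd) functional" where
  "partial \<mu> L = Abs_mps (\<lambda>M. - \<i> * complex_of_real (total_momentum M $ \<mu>) * mps_coeff L M)"

text \<open>The integral over spacetime keeps the terms of vanishing total momentum.\<close>

definition spacetime_integral :: "('i, 'd::finite) functional \<Rightarrow> ('i, 'd) functional" where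
  "spacetime_integral L = Abs_mps (\<lambda>M. if total_momentum M = 0 then mps_coeff L M else 0)"

definition translation_invariant :: "('i, 'd::finite) functional \<Rightarrow> bool" where
  "translation_invariant A \<longleftrightarrow> (\<forall>M. total_momentum M \<noteq> 0 \<longrightarrow> mps_coeff A M = 0)"

inductive_set differential_polynomials :: "('i, 'd::finite) functional set" where
  "mps_const c \<in> differential_polynomials"
| "fluctuation i \<in> differential_polynomials"
| "L \<in> differential_polynomials \<Longrightarrow> partial \<mu> L \<in> differential_polynomials"
| "L \<in> differential_polynomials \<Longrightarrow> L' \<in> differential_polynomials \<Longrightarrow>
     L + L' \<in> differential_polynomials"
| "L \<in> differential_polynomials \<Longrightarrow> L' \<in> differential_polynomials \<Longrightarrow>
     L * L' \<in> differential_polynomials"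

text \<open>
  Local Lagrangians need not be polynomial in the undifferentiated fields (as with the inverse
  metric); locality is therefore imposed order by order in the fluctuations.
\<close>

definition local_density :: "('i, 'd::finite) functional \<Rightarrow> bool" where
  "local_density L \<longleftrightarrow>
     (\<forall>N. \<exists>L'\<in>differential_polynomials. \<forall>M. size M \<le> N \<longrightarrow> mps_coeff L M = mps_coeff L' M)"

section \<open>Einstein gravity coupled to matter\<close>

instance uprod :: (finite) finite
  by standard simp

text \<open>
  Spacetime indices range over the finite type \<open>'d\<close>, whose cardinality is the dimension; \<open>t\<close> is
  the time direction. The field labels are the independent components of the symmetric tensor
  \<open>h = g - \<eta>\<close> (unordered pairs of spacetime indices) and the matter labels \<open>'m\<close>. Matter fields
  are fluctuations around their constant vacuum values.
\<close>

definition minkowski :: "'d \<Rightarrow> 'd \<Rightarrow> 'd \<Rightarrow> real" where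
  "minkowski t \<mu> \<nu> = (if \<mu> \<noteq> \<nu> then 0 else if \<mu> = t then - 1 else 1)"

definition minkowski_square :: "'d::finite \<Rightarrow> real ^ 'd \<Rightarrow> real" where
  "minkowski_square t p = (\<Sum>\<mu>\<in>UNIV. \<Sum>\<nu>\<in>UNIV. minkowski t \<mu> \<nu> * p $ \<mu> * p $ \<nu>)"

type_synonym ('m, 'd) grav_functional = "('d uprod + 'm, 'd) functional"

definition spacetime_metric :: "'d::finite \<Rightarrow> ('m, 'd) grav_functional ^ 'd ^ 'd" where
  "spacetime_metric t = (\<chi> \<mu> \<nu>. mps_const (complex_of_real (minkowski t \<mu> \<nu>)) + fluctuation (Inl (Upair \<mu> \<nu>)))"

definition inverse_metric :: "'d::finite \<Rightarrow> ('m, 'd) grav_functional ^ 'd ^ 'd" where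
  "inverse_metric t = matrix_inv (spacetime_metric t)"

text \<open>In Lorentzian signature \<open>\<bar>g\<bar> = - det g\<close>; the root is the one equal to \<open>1\<close> at \<open>h = 0\<close>.\<close>

definition sqrt_abs_det :: "'d::finite \<Rightarrow> ('m, 'd) grav_functional" where
  "sqrt_abs_det t = (THE s. s * s = - det (spacetime_metric t) \<and> mps_coeff s {#} = 1)"

lemma det_spacetime_metric_background: "mps_coeff (det (spacetime_metric t :: ('m, 'd::finite) grav_functional ^ 'd ^ 'd)) {#} = - 1"
proof -
  have prod0: "mps_coeff (prod f S) {#} = (\<Prod>x\<in>S. mps_coeff (f x) {#})" for S and f :: "'b \<Rightarrow> 'v mps"
    by (induction S rule: infinite_finite_induct) auto
  have of_int0: "mps_coeff (of_int k :: 'v mps) {#} = of_int k" for k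
    by (induction k rule: int_induct[where k = 0]) auto
  have "mps_coeff (det (spacetime_metric t :: ('m, 'd) grav_functional ^ 'd ^ 'd)) {#}
      = det (\<chi> \<mu> \<nu>. complex_of_real (minkowski t \<mu> \<nu>) :: complex ^ 'd ^ 'd)"
    by (simp add: det_def spacetime_metric_def prod0 of_int0 fluctuation_def)
  also have "\<dots> = (\<Prod>i\<in>UNIV. complex_of_real (minkowski t i i))"
    by (subst det_diagonal) (auto simp: minkowski_def)
  also have "\<dots> = (\<Prod>i\<in>UNIV. if i = t then - 1 else 1)"
    by (rule prod.cong) (auto simp: minkowski_def)
  also have "\<dots> = - 1" by simp
  finally show ?thesis .
qed

lemma sqrt_abs_det_unique_root:
  fixes t :: "'d::finite"
  defines "r \<equiv> (sqrt_abs_det t :: ('m, 'd) grav_functional)"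
  shows "r * r = - det (spacetime_metric t) \<and> mps_coeff r {#} = 1"
proof -
  have "mps_coeff (- det (spacetime_metric t :: ('m, 'd) grav_functional ^ 'd ^ 'd)) {#} = 1" by (simp add: det_spacetime_metric_background)
  from theI'[OF mps_sqrt_exists[OF this]] show ?thesis unfolding r_def sqrt_abs_det_def .
qed

lemma invertible_spacetime_metric: "invertible (spacetime_metric t :: ('m, 'd::finite) grav_functional ^ 'd ^ 'd)"
proof -
  let ?g = "spacetime_metric t :: ('m, 'd) grav_functional ^ 'd ^ 'd"
  define e where "e = ((\<chi> \<mu> \<nu>. mps_const (complex_of_real (minkowski t \<mu> \<nu>))) :: ('m, 'd) grav_functional ^ 'd ^ 'd)"
  have ee: "e ** e = mat 1"
  proof -
    have c0: "mps_const 0 = 0" "mps_const 1 = 1" by (rule mps_eqI, simp)+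
    have "(\<Sum>k\<in>UNIV. mps_const (complex_of_real (minkowski t i k * minkowski t k j)))
        = (if i = j then 1 else (0 :: ('m, 'd) grav_functional))" for i j
    proof -
      have "(\<Sum>k\<in>UNIV. mps_const (complex_of_real (minkowski t i k * minkowski t k j)))
        = (\<Sum>k\<in>UNIV. if k = i then (if i = j then 1 else (0 :: ('m, 'd) grav_functional)) else 0)"
        by (rule sum.cong) (auto simp: minkowski_def c0)
      thus ?thesis by simp
    qed
    thus ?thesis by (simp add: vec_eq_iff matrix_matrix_mult_def e_def mat_def mps_const_mult)
  qed
  define X where "X = mat 1 - e ** ?g"
  define h where "h = ?g - e"
  have "X = - (e ** h)" by (simp add: X_def h_def matrix_sub_ld ee)
  moreover have "mps_coeff (h $ i $ j) {#} = 0" for i j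
    by (simp add: h_def e_def spacetime_metric_def fluctuation_def)
  ultimately have "\<And>i j. mps_order_ge (Suc 0) (X $ i $ j)"
    by (simp add: mps_order_ge_1 matrix_matrix_mult_def)
  from mps_matrix_inverse_exists[OF this] obtain N where "(e ** ?g) ** N = mat 1" "N ** (e ** ?g) = mat 1" by (auto simp: X_def)
  hence "?g ** (N ** e) = mat 1" "(N ** e) ** ?g = mat 1"
    using ee by (simp_all add: matrix_mul_assoc) (metis matrix_mul_assoc matrix_mul_lid matrix_mul_rid)
  thus ?thesis unfolding invertible_def by blast
qed

definition christoffel ::
    "'d::finite \<Rightarrow> 'd \<Rightarrow> 'd \<Rightarrow> 'd \<Rightarrow> ('m, 'd) grav_functional" where
  "christoffel t \<rho> \<mu> \<nu> = mps_const (1 / 2) * (\<Sum>\<sigma>\<in>UNIV. inverse_metric t $ \<rho> $ \<sigma> *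
     (partial \<mu> (spacetime_metric t $ \<sigma> $ \<nu>) + partial \<nu> (spacetime_metric t $ \<sigma> $ \<mu>) - partial \<sigma> (spacetime_metric t $ \<mu> $ \<nu>)))"

definition ricci :: "'d::finite \<Rightarrow> 'd \<Rightarrow> 'd \<Rightarrow> ('m, 'd) grav_functional" where
  "ricci t \<mu> \<nu> = (\<Sum>\<rho>\<in>UNIV. partial \<rho> (christoffel t \<rho> \<mu> \<nu>) - partial \<nu> (christoffel t \<rho> \<mu> \<rho>))
     + (\<Sum>\<rho>\<in>UNIV. \<Sum>\<sigma>\<in>UNIV. christoffel t \<rho> \<rho> \<sigma> * christoffel t \<sigma> \<mu> \<nu>
                              - christoffel t \<rho> \<nu> \<sigma> * christoffel t \<sigma> \<mu> \<rho>)"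

definition ricci_scalar :: "'d::finite \<Rightarrow> ('m, 'd) grav_functional" where
  "ricci_scalar t = (\<Sum>\<mu>\<in>UNIV. \<Sum>\<nu>\<in>UNIV. inverse_metric t $ \<mu> $ \<nu> * ricci t \<mu> \<nu>)"

definition local_action ::
    "'d::finite \<Rightarrow> real \<Rightarrow> ('m, 'd) grav_functional \<Rightarrow> ('m, 'd) grav_functional" where
  "local_action t \<kappa> Lm = spacetime_integral
     (sqrt_abs_det t * (mps_const (complex_of_real (1 / (2 * \<kappa>\<^sup>2))) * ricci_scalar t + Lm))"

section \<open>The nonlocal action\<close>

text \<open>
  The flat field-space metric with components \<open>\<gamma>\<close> (written here with upper indices) is local, so
  on modes it pairs \<open>(i, p)\<close> with \<open>(j, -p)\<close>. It is needed to contract two derivatives of the action;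
  \<open>\<gamma> = mat 1\<close> gives the convention in which index position is ignored altogether.
\<close>

definition eom :: "('i, 'd::finite) functional \<Rightarrow> 'i \<times> (real ^ 'd) \<Rightarrow> ('i, 'd) functional" where
  "eom S a = mps_deriv a S"

definition hessian ::
    "('i, 'd::finite) functional \<Rightarrow> 'i \<times> (real ^ 'd) \<Rightarrow> 'i \<times> (real ^ 'd) \<Rightarrow> ('i, 'd) functional" where
  "hessian S a b = mps_deriv a (eom S b)"

definition raise_index ::
    "real ^ 'i ^ 'i \<Rightarrow> ('i::finite \<times> (real ^ 'd::finite) \<Rightarrow> ('i, 'd) functional)
      \<Rightarrow> 'i \<times> (real ^ 'd) \<Rightarrow> ('i, 'd) functional" where
  "raise_index \<gamma> X = (\<lambda>(i, p). \<Sum>j\<in>UNIV. mps_const (complex_of_real (\<gamma> $ i $ j)) * X (j, - p))"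

type_synonym ('i, 'd) field_operator =
  "'i \<times> (real ^ 'd) \<Rightarrow> 'i \<times> (real ^ 'd) \<Rightarrow> ('i, 'd) functional"

definition hessian_operator ::
    "real ^ 'i ^ 'i \<Rightarrow> ('i::finite, 'd::finite) functional \<Rightarrow> ('i, 'd) field_operator" where
  "hessian_operator \<gamma> S a = raise_index \<gamma> (hessian S a)"

fun op_power :: "('i, 'd::finite) field_operator \<Rightarrow> nat \<Rightarrow> ('i, 'd) field_operator" where
  "op_power T 0 a b = (if a = b then 1 else 0)"
| "op_power T (Suc m) a b = mps_Sum (\<lambda>c. T a c * op_power T m c b)"

text \<open>An entire function \<open>f\<close> of an operator, through the Taylor series of \<open>f\<close> at \<open>0\<close>.\<close>

definition op_apply ::
    "(complex \<Rightarrow> complex) \<Rightarrow> ('i, 'd::finite) field_operator \<Rightarrow> ('i, 'd) field_operator" where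
  "op_apply f T a b = Abs_mps (\<lambda>M. suminf (\<lambda>m. (deriv ^^ m) f 0 / fact m * mps_coeff (op_power T m a b) M))"

text \<open>
  The value at \<open>z = 0\<close> is the mass-shell condition \<open>exp (H 0) = 1\<close>: on the background the Hessian
  is \<open>-(k\<^sup>2 + m\<^sup>2)\<close> (with its tensor structure), which annihilates on-shell modes.
\<close>

definition form_factor :: "(complex \<Rightarrow> complex) \<Rightarrow> (complex \<Rightarrow> complex) \<Rightarrow> bool" where
  "form_factor H F \<longleftrightarrow> H holomorphic_on UNIV \<and> F holomorphic_on UNIV \<and>
     (\<forall>z. 2 * z * F z = exp (H z) - 1)"

text \<open>
  \<open>V = O(E\<^sup>3)\<close>. The coefficients \<open>W\<close> may depend on the fields, hence also on \<open>E\<close>, so terms of higher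
  order in \<open>E\<close> are included.
\<close>

definition at_least_cubic ::
    "('i \<times> (real ^ 'd::finite) \<Rightarrow> ('i, 'd) functional) \<Rightarrow> ('i, 'd) functional \<Rightarrow> bool" where
  "at_least_cubic E V \<longleftrightarrow> (\<exists>W. V = mps_Sum (\<lambda>(a, b, c). W a b c * E a * E b * E c))"

definition nonlocal_action ::
    "real ^ 'i ^ 'i \<Rightarrow> (complex \<Rightarrow> complex) \<Rightarrow> ('i::finite, 'd::finite) functional \<Rightarrow> ('i, 'd) functional
      \<Rightarrow> ('i, 'd) functional" where
  "nonlocal_action \<gamma> F S V = S
     + mps_Sum (\<lambda>(a, b). raise_index \<gamma> (eom S) a * op_apply F (hessian_operator \<gamma> S) a b * eom S b)
     + V"

section \<open>Perturbative solutions and tree-level amplitudes\<close>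

text \<open>
  The kinetic matrix acts on the mode of momentum \<open>k\<close>. The equation of motion \<open>eom S (i, q)\<close> is the
  coefficient of \<open>exp(\<i> q x)\<close>, whence the sign in the first index.
\<close>

definition kinetic :: "('i, 'd::finite) functional \<Rightarrow> real ^ 'd \<Rightarrow> complex ^ 'i ^ 'i" where
  "kinetic S k = (\<chi> i j. mps_coeff (hessian S (i, - k) (j, k)) {#})"

text \<open>
  A gauge-fixing term quadratic in the fields is given by its kinetic matrix \<open>Q\<close>, and the gauge
  condition is \<open>Q k *v \<phi> = 0\<close>. It must make the kinetic matrix invertible at every momentum at
  which no mode solves the free equation of motion together with the gauge condition; without
  gauge symmetry one can take \<open>Q = 0\<close>. Theories are compared in a common gauge, that is with the same
  kernels of \<open>Q\<close>; the gauge-fixing terms themselves may differ by a form-factor weight, as in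
  \<open>exp(H) Q\<close>, for which the Green function acquires exactly the factor \<open>exp(-H)\<close>. With the sign of the kinetic matrix, the Green function
  below is \<open>-1/(k\<^sup>2 + m\<^sup>2)\<close> for a free local scalar.
\<close>

definition gauge_fixing ::
    "('i::finite, 'd::finite) functional \<Rightarrow> (real ^ 'd \<Rightarrow> complex ^ 'i ^ 'i) \<Rightarrow> bool" where
  "gauge_fixing S Q \<longleftrightarrow> (\<forall>k. (\<forall>v. kinetic S k *v v = 0 \<and> Q k *v v = 0 \<longrightarrow> v = 0) \<longrightarrow>
     invertible (kinetic S k + Q k))"

definition green ::
    "('i::finite, 'd::finite) functional \<Rightarrow> (real ^ 'd \<Rightarrow> complex ^ 'i ^ 'i) \<Rightarrow> real ^ 'd \<Rightarrow> complex ^ 'i ^ 'i" where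
  "green S Q k = matrix_inv (kinetic S k + Q k)"

definition off_shell ::
    "('i::finite, 'd::finite) functional \<Rightarrow> (real ^ 'd \<Rightarrow> complex ^ 'i ^ 'i) \<Rightarrow> real ^ 'd \<Rightarrow> bool" where
  "off_shell S Q k \<longleftrightarrow> invertible (kinetic S k + Q k)"

text \<open>An external leg is a momentum with a nonzero wave function (polarisation) solving the free equation.\<close>

definition on_shell ::
    "'d::finite \<Rightarrow> ('i::finite, 'd) functional \<Rightarrow> (real ^ 'd \<Rightarrow> complex ^ 'i ^ 'i) \<Rightarrow> real
      \<Rightarrow> (real ^ 'd) \<times> (complex ^ 'i) \<Rightarrow> bool" where
  "on_shell t S Q m = (\<lambda>(p, u). minkowski_square t p = - m\<^sup>2 \<and> u \<noteq> 0 \<and>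
     kinetic S p *v u = 0 \<and> Q p *v u = 0)"

text \<open>
  The free field is \<open>\<Phi>\<^sup>(\<^sup>0\<^sup>) = (\<Sum>j<N. \<epsilon>\<^sub>j u\<^sub>j exp(-\<i> p\<^sub>j x))\<close>, and only the terms that are at most linear in
  each \<open>\<epsilon>\<^sub>j\<close> are kept. The coefficient of \<open>\<Prod>j\<in>P. \<epsilon>\<^sub>j\<close> in the solution is \<open>\<phi> P\<close> times a plane wave
  of momentum \<open>\<Sum>j\<in>P. p\<^sub>j\<close>, so the sets \<open>P\<close> with \<open>m + 1\<close> elements make up \<open>\<Phi>\<^sup>(\<^sup>m\<^sup>)\<close>, and \<open>\<phi> {..<N}\<close> is the
  functional derivative of \<open>\<Phi>\<^sup>(\<^sup>N\<^sup>-\<^sup>1\<^sup>)\<close> with respect to the amplitudes \<open>\<epsilon>\<^sub>j\<close> of all \<open>N\<close> plane waves.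
\<close>

definition plane_wave_field ::
    "nat \<Rightarrow> (nat \<Rightarrow> real ^ 'd::finite) \<Rightarrow> (nat set \<Rightarrow> complex ^ 'i) \<Rightarrow> 'i \<times> (real ^ 'd) \<Rightarrow> nat mps" where
  "plane_wave_field N p \<phi> = (\<lambda>(i, q). Abs_mps (\<lambda>M.
     if M \<noteq> {#} \<and> (\<exists>P\<subseteq>{..<N}. M = mset_set P) \<and> q = (\<Sum>j\<in>set_mset M. p j)
     then \<phi> (set_mset M) $ i else 0))"

definition perturbative_solution ::
    "('i::finite, 'd::finite) functional \<Rightarrow> (real ^ 'd \<Rightarrow> complex ^ 'i ^ 'i) \<Rightarrow> nat
      \<Rightarrow> (nat \<Rightarrow> (real ^ 'd) \<times> (complex ^ 'i)) \<Rightarrow> (nat set \<Rightarrow> complex ^ 'i) \<Rightarrow> bool" where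
  "perturbative_solution S Q N legs \<phi> \<longleftrightarrow>
     (\<forall>j<N. \<phi> {j} = snd (legs j)) \<and>
     (\<forall>P\<subseteq>{..<N}. P \<noteq> {} \<longrightarrow>
        (\<forall>a. mps_coeff (mps_subst (eom S a) (plane_wave_field N (fst \<circ> legs) \<phi>)) (mset_set P) = 0) \<and>
        Q (\<Sum>j\<in>P. fst (legs j)) *v \<phi> P = 0)"

text \<open>
  Configurations at which the recursion for the solution has a unique answer: the legs are on
  shell, while every sum of at least two of their momenta avoids the poles of the propagator.
\<close>

definition generic_legs ::
    "'d::finite \<Rightarrow> ('i::finite, 'd) functional \<Rightarrow> (real ^ 'd \<Rightarrow> complex ^ 'i ^ 'i) \<Rightarrow> nat
      \<Rightarrow> (nat \<Rightarrow> real) \<Rightarrow> (nat \<Rightarrow> (real ^ 'd) \<times> (complex ^ 'i)) set" where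
  "generic_legs t S Q N m = {legs. (\<forall>j<N. on_shell t S Q (m j) (legs j)) \<and>
     (\<forall>P\<subseteq>{..<N}. 2 \<le> card P \<longrightarrow> off_shell S Q (\<Sum>j\<in>P. fst (legs j)))}"

text \<open>
  Legs \<open>0, \<dots>, n - 2\<close> are the sources and leg \<open>n - 1\<close> is amputated. By momentum conservation
  \<open>\<phi> {..<n - 1}\<close> has momentum \<open>-p\<^sub>n\<close>, and \<open>p\<^sub>n\<close> reaches its mass shell as the sources vary over
  generic on-shell legs. The limit carries the free index of the last field, which is then
  contracted with the wave function of the last leg. The condition that the filter is not
  trivial makes the amplitude unique.
\<close>

definition has_tree_amplitude ::
    "'d::finite \<Rightarrow> ('i::finite, 'd) functional \<Rightarrow> (real ^ 'd \<Rightarrow> complex ^ 'i ^ 'i) \<Rightarrow> nat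
      \<Rightarrow> (nat \<Rightarrow> real) \<Rightarrow> (nat \<Rightarrow> (real ^ 'd) \<times> (complex ^ 'i)) \<Rightarrow> complex \<Rightarrow> bool" where
  "has_tree_amplitude t S Q n m legs A \<longleftrightarrow>
     (let limit = at legs within generic_legs t S Q (n - 1) m in
      limit \<noteq> bot \<and>
      (\<exists>\<phi> J. (\<forall>\<^sub>F l in limit. perturbative_solution S Q (n - 1) l (\<phi> l)) \<and>
         ((\<lambda>l. (1 / \<i>) *s (matrix_inv (green S Q (\<Sum>j<n - 1. fst (l j))) *v \<phi> l {..<n - 1}))
            \<longlongrightarrow> J) limit \<and>
         A = (\<Sum>i\<in>UNIV. snd (legs (n - 1)) $ i * J $ i)))"

end

theory Submission
  imports Defs
begin

text \<open>
  By the chain rule, every term of the equations of motion of \<open>S\<close> contains a factor \<open>E\<close>, so to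
  leading order in \<open>E\<close> they read \<open>exp(H(\<Delta>)) E\<close>, where \<open>\<Delta>\<close> may be evaluated on the background
  and the factor \<open>dressing = 1 + 2 \<Delta> F(\<Delta>) = exp(H(\<Delta>))\<close> is an invertible matrix for each momentum.
  Order by order in the external legs the two theories therefore have the same perturbative
  solutions. Their kinetic matrices differ by the same factor. In the amputation this factor
  tends to its value on the mass shell of the last leg, where it acts as the identity on the wave function.

  Two points avoid analysis of \<open>F(\<Delta>)\<close> at higher orders in the fields: only its background value
  enters, and all DeWitt sums are finite in each order by momentum conservation alone. Locality is
  used only to make the kinetic matrix continuous in the momentum.
\<close>

unbundle no fps_syntax

section \<open>Entire functions of matrices\<close>

text \<open>The comparison runs over sets \<open>P\<close> of legs. If \<open>E\<close> vanishes at
  every proper subset of \<open>P\<close>, then a product of two factors \<open>E\<close> has no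
  coefficient at \<open>P\<close>. This removes the variation of \<open>V\<close>, which leaves at
  least two of its three factors, and the variation of \<open>F(\<Delta>)\<close>, which stands
  between two. What survives is a single \<open>E\<close> times background constants.

  The quadratic term contributes twice. Varying its left factor gives \<open>B F(B)\<close>, with
  \<open>B\<close> the background Hessian operator. Varying its right factor gives a transposed
  expression at the opposite momentum, and the two agree because \<open>F(B)\<close> is self-adjoint
  for the field metric. This is the origin of the 2 in \<open>1 + 2 B F(B)\<close>.

  Two features of this matrix are used. A scalar identity gives it the explicit inverse
  \<open>exp(-H(B))\<close>, so that the equations can be compared in both directions. And its
  nontrivial part begins on the left with the kinetic matrix, whose transpose annihilates the wave
  function of the last leg; hence the matrix acts on that wave function as the identity, without any
  diagonalisation.\<close>

primrec mat_pow :: "'a::comm_ring_1 ^ 'n::finite ^ 'n \<Rightarrow> nat \<Rightarrow> 'a ^ 'n ^ 'n" where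
  "mat_pow A 0 = mat 1"
| "mat_pow A (Suc m) = A ** mat_pow A m"

text \<open>Used with \<open>C\<close> equal to the matrix itself, where it says that powers commute
  with their base, and through \<open>mat_fun_intertwine\<close> with the field metric as
  \<open>C\<close>.\<close>

lemma mat_pow_intertwine:
  fixes A B C :: "'a::comm_ring_1 ^ 'n::finite ^ 'n"
  assumes "A ** C = C ** B"
  shows "mat_pow A m ** C = C ** mat_pow B m"
proof (induction m)
  case (Suc m)
  have "mat_pow A (Suc m) ** C = A ** (C ** mat_pow B m)"
    by (simp add: Suc flip: matrix_mul_assoc)
  then show ?case by (simp add: matrix_mul_assoc assms)
qed simp

lemma mat_pow_add: "mat_pow A (m + l) = mat_pow A m ** mat_pow A l"
  by (induction m) (simp_all add: matrix_mul_assoc)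

lemma transpose_mat_pow: "transpose (mat_pow A m) = mat_pow (transpose A) m"
proof (induction m)
  case (Suc m)
  have "transpose (mat_pow A (Suc m)) = mat_pow (transpose A) m ** transpose A"
    by (simp add: Suc matrix_transpose_mul)
  also have "\<dots> = transpose A ** mat_pow (transpose A) m"
    by (rule mat_pow_intertwine) simp
  finally show ?case by simp
qed simp

lemma norm_mat_pow_le:
  fixes A :: "complex ^ 'n::finite ^ 'n"
  assumes "\<And>i j. norm (A $ i $ j) \<le> B"
  shows "norm (mat_pow A m $ i $ j) \<le> (of_nat CARD('n) * B) ^ m"
proof (induction m arbitrary: i)
  case 0
  then show ?case by (simp add: mat_def)
next
  case (Suc m)
  have B: "0 \<le> B" using assms[of undefined undefined] norm_ge_zero order_trans by blast
  have "norm (mat_pow A (Suc m) $ i $ j) \<le> (\<Sum>k\<in>UNIV. norm (A $ i $ k * mat_pow A m $ k $ j))"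
    by (simp add: matrix_matrix_mult_def norm_sum)
  also have "\<dots> \<le> (\<Sum>k\<in>(UNIV::'n set). B * (of_nat CARD('n) * B) ^ m)"
    unfolding norm_mult by (intro sum_mono mult_mono assms Suc B norm_ge_zero)
  finally show ?case by simp
qed

text \<open>Entrywise series of the same shape as \<open>op_apply\<close>, so that the background
  value of \<open>op_apply f T\<close> is \<open>mat_fun f\<close> of the background of
  \<open>T\<close> term by term.\<close>

definition mat_fun :: "(complex \<Rightarrow> complex) \<Rightarrow> complex ^ 'n::finite ^ 'n \<Rightarrow> complex ^ 'n ^ 'n" where
  "mat_fun f A = (\<chi> i j. suminf (\<lambda>m. (deriv ^^ m) f 0 / fact m * mat_pow A m $ i $ j))"

lemma entire_taylor_summable:
  assumes "f holomorphic_on UNIV"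
  shows "summable (\<lambda>m. norm ((deriv ^^ m) f 0 / fact m) * R ^ m)"
proof -
  \<comment> \<open>A point of modulus strictly greater than that of \<open>R\<close>: convergence
    at \<open>w\<close> gives absolute convergence at \<open>R\<close>.\<close>
  define w where "w = complex_of_real (\<bar>R\<bar> + 1)"
  have "(\<lambda>m. (deriv ^^ m) f 0 / fact m * (w - 0) ^ m) sums f w"
    by (rule holomorphic_power_series[where r = "\<bar>R\<bar> + 2"])
       (use assms in \<open>auto simp: w_def simp del: of_real_add intro: holomorphic_on_subset\<close>)
  hence "summable (\<lambda>m. norm ((deriv ^^ m) f 0 / fact m * complex_of_real R ^ m))"
    by (intro powser_insidea[where x = w]) (auto simp: sums_iff w_def simp del: of_real_add)
  hence "summable (\<lambda>m. norm (norm ((deriv ^^ m) f 0 / fact m) * R ^ m))"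
    by (simp add: norm_mult norm_power norm_divide abs_mult power_abs)
  thus ?thesis by (rule summable_norm_cancel)
qed

text \<open>The majorant depends on \<open>A\<close> only through the entry bound, so it serves both
  for a single matrix and uniformly on a ball of matrices.\<close>

lemma mat_fun_bound:
  fixes A :: "complex ^ 'n::finite ^ 'n"
  assumes "\<And>i j. norm (A $ i $ j) \<le> B"
  shows "norm ((deriv ^^ m) f 0 / fact m * mat_pow A m $ i $ j)
       \<le> norm ((deriv ^^ m) f 0 / fact m) * (of_nat CARD('n) * B) ^ m"
  unfolding norm_mult by (intro mult_left_mono norm_mat_pow_le assms norm_ge_zero)

lemma mat_fun_summable:
  fixes A :: "complex ^ 'n::finite ^ 'n"
  assumes f: "f holomorphic_on UNIV"
  shows "summable (\<lambda>m. norm ((deriv ^^ m) f 0 / fact m * mat_pow A m $ i $ j))"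
proof (rule summable_comparison_test'[OF entire_taylor_summable[OF f]])
  fix m
  have "norm (A $ i $ j) \<le> norm A" for i j
    by (meson Finite_Cartesian_Product.norm_nth_le order_trans)
  from mat_fun_bound[of A, OF this]
  show "norm (norm ((deriv ^^ m) f 0 / fact m * mat_pow A m $ i $ j))
      \<le> norm ((deriv ^^ m) f 0 / fact m) * (of_nat CARD('n) * norm A) ^ m" by simp
qed

lemma mat_fun_intertwine:
  fixes A B C :: "complex ^ 'n::finite ^ 'n"
  assumes f: "f holomorphic_on UNIV" and AC: "A ** C = C ** B"
  shows "mat_fun f A ** C = C ** mat_fun f B"
proof -
  note s = summable_norm_cancel[OF mat_fun_summable[OF f]]
  have "(mat_fun f A ** C) $ i $ j = (C ** mat_fun f B) $ i $ j" for i j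
  proof -
    have "(mat_fun f A ** C) $ i $ j
        = (suminf (\<lambda>m. \<Sum>k\<in>UNIV. (deriv ^^ m) f 0 / fact m * mat_pow A m $ i $ k * C $ k $ j))"
      unfolding matrix_matrix_mult_def mat_fun_def
      by (simp only: vec_lambda_beta suminf_mult2[OF s] suminf_sum[OF summable_mult2[OF s]])
    also have "\<dots> = (suminf (\<lambda>m. (deriv ^^ m) f 0 / fact m * (mat_pow A m ** C) $ i $ j))"
      by (simp add: matrix_matrix_mult_def sum_distrib_left mult.assoc)
    also have "\<dots> = (suminf (\<lambda>m. (deriv ^^ m) f 0 / fact m * (C ** mat_pow B m) $ i $ j))"
      by (simp only: mat_pow_intertwine[OF AC])
    also have "\<dots> = (suminf (\<lambda>m. \<Sum>k\<in>UNIV. C $ i $ k * ((deriv ^^ m) f 0 / fact m * mat_pow B m $ k $ j)))"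
      by (simp add: matrix_matrix_mult_def sum_distrib_left mult.left_commute)
    also have "\<dots> = (C ** mat_fun f B) $ i $ j"
      unfolding matrix_matrix_mult_def mat_fun_def
      by (simp only: vec_lambda_beta suminf_mult[OF s] suminf_sum[OF summable_mult[OF s]])
    finally show ?thesis .
  qed
  thus ?thesis by (simp add: vec_eq_iff)
qed

lemma transpose_mat_fun: "transpose (mat_fun f A) = mat_fun f (transpose A)"
proof -
  have "mat_pow A m $ j $ i = mat_pow (transpose A) m $ i $ j" for m i j
    unfolding transpose_mat_pow[symmetric] by (simp add: transpose_def)
  thus ?thesis by (simp add: mat_fun_def transpose_def)
qed

text \<open>Uniqueness of the power series expansion: the expansion of the product is the product of
  the expansions.\<close>

lemma entire_taylor_mult:
  assumes "f holomorphic_on UNIV" "g holomorphic_on UNIV"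
  shows "(deriv ^^ n) (\<lambda>z. f z * g z) 0 / fact n
       = (\<Sum>m\<le>n. ((deriv ^^ m) f 0 / fact m) * ((deriv ^^ (n - m)) g 0 / fact (n - m)))"
proof -
  have e: "h has_fps_expansion fps_expansion h 0" if "h holomorphic_on UNIV" for h
    using that by (intro has_fps_expansion_fps_expansion[of UNIV]) auto
  have "(\<lambda>z. f z * g z) has_fps_expansion fps_expansion f 0 * fps_expansion g 0"
    by (intro has_fps_expansion_mult e assms)
  moreover have "(\<lambda>z. f z * g z) has_fps_expansion fps_expansion (\<lambda>z. f z * g z) 0"
    by (intro e holomorphic_intros assms)
  ultimately have "fps_expansion (\<lambda>z. f z * g z) 0 = fps_expansion f 0 * fps_expansion g 0"
    using fps_expansion_unique_complex by blast
  from arg_cong[OF this, of "\<lambda>F. fps_nth F n"] show ?thesis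
    by (simp add: fps_mult_nth fps_expansion_def atLeast0AtMost)
qed

text \<open>Cauchy product of absolutely convergent series; \<open>mat_pow_add\<close> makes the
  matrix part of a term depend only on the total degree.\<close>

lemma mat_fun_mult:
  assumes f: "f holomorphic_on UNIV" and g: "g holomorphic_on UNIV"
  shows "mat_fun (\<lambda>z. f z * g z) A = mat_fun f A ** mat_fun g A"
proof -
  let ?a = "\<lambda>h m. (deriv ^^ m) h 0 / fact m"
  have "(mat_fun f A ** mat_fun g A) $ i $ j = mat_fun (\<lambda>z. f z * g z) A $ i $ j" for i j
  proof -
    have "(\<lambda>n. \<Sum>k\<in>UNIV. \<Sum>m\<le>n. (?a f m * mat_pow A m $ i $ k) * (?a g (n - m) * mat_pow A (n - m) $ k $ j))
        sums (mat_fun f A ** mat_fun g A) $ i $ j"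
      unfolding matrix_matrix_mult_def mat_fun_def
      by (simp only: vec_lambda_beta) (intro sums_sum Cauchy_product_sums mat_fun_summable f g)
    also have "(\<lambda>n. \<Sum>k\<in>UNIV. \<Sum>m\<le>n. (?a f m * mat_pow A m $ i $ k) * (?a g (n - m) * mat_pow A (n - m) $ k $ j))
        = (\<lambda>n. ?a (\<lambda>z. f z * g z) n * mat_pow A n $ i $ j)"
    proof
      fix n
      have "mat_pow A n $ i $ j = (\<Sum>k\<in>UNIV. mat_pow A m $ i $ k * mat_pow A (n - m) $ k $ j)" if "m \<le> n" for m
        using mat_pow_add[of A m "n - m"] that by (simp add: matrix_matrix_mult_def)
      hence "?a (\<lambda>z. f z * g z) n * mat_pow A n $ i $ j
          = (\<Sum>m\<le>n. ?a f m * ?a g (n - m) * (\<Sum>k\<in>UNIV. mat_pow A m $ i $ k * mat_pow A (n - m) $ k $ j))"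
        unfolding entire_taylor_mult[OF f g] sum_distrib_right by (intro sum.cong) auto
      also have "\<dots> = (\<Sum>k\<in>UNIV. \<Sum>m\<le>n. (?a f m * mat_pow A m $ i $ k) * (?a g (n - m) * mat_pow A (n - m) $ k $ j))"
        by (subst sum.swap) (simp only: sum_distrib_left mult_ac)
      finally show "(\<Sum>k\<in>UNIV. \<Sum>m\<le>n. (?a f m * mat_pow A m $ i $ k) * (?a g (n - m) * mat_pow A (n - m) $ k $ j))
          = ?a (\<lambda>z. f z * g z) n * mat_pow A n $ i $ j" by (rule sym)
    qed
    finally show ?thesis by (simp add: sums_iff mat_fun_def)
  qed
  thus ?thesis by (simp add: vec_eq_iff)
qed

lemma mat_fun_const: "mat_fun (\<lambda>_. c) (A :: complex ^ 'n::finite ^ 'n) = (\<chi> i j. c * mat 1 $ i $ j)"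
proof -
  have "(\<lambda>m. (deriv ^^ m) (\<lambda>_. c) 0 / fact m * mat_pow A m $ i $ j) = (\<lambda>m. if m = 0 then c * mat 1 $ i $ j else 0)" for i j
    by (auto simp: higher_deriv_const)
  moreover have "suminf (\<lambda>m. if m = 0 then c * mat 1 $ i $ j else 0) = c * mat 1 $ i $ j" for i j :: 'n
    by (rule sums_unique[OF sums_single, symmetric])
  ultimately show ?thesis by (simp only: mat_fun_def)
qed

lemma mat_fun_ident: "mat_fun (\<lambda>z. z) A = A"
proof -
  have "(\<lambda>m. (deriv ^^ m) (\<lambda>z. z) 0 / fact m * mat_pow A m $ i $ j) = (\<lambda>m. if m = 1 then A $ i $ j else 0)" for i j
    by (auto simp: higher_deriv_ident)
  moreover have "suminf (\<lambda>m. if m = 1 then A $ i $ j else 0) = A $ i $ j" for i j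
    by (rule sums_unique[OF sums_single, symmetric])
  ultimately show ?thesis by (simp only: mat_fun_def) (simp add: vec_eq_iff)
qed

lemma mat_fun_add:
  assumes f: "f holomorphic_on UNIV" and g: "g holomorphic_on UNIV"
  shows "mat_fun (\<lambda>z. f z + g z) A = mat_fun f A + mat_fun g A"
proof -
  note s = summable_norm_cancel[OF mat_fun_summable[OF f]] summable_norm_cancel[OF mat_fun_summable[OF g]]
  show ?thesis
    unfolding vec_eq_iff mat_fun_def vector_add_component vec_lambda_beta suminf_add[OF s]
    by (simp add: higher_deriv_add[OF f g] add_divide_distrib distrib_right)
qed

lemma continuous_on_mat_pow: "continuous_on S (\<lambda>A :: complex ^ 'n::finite ^ 'n. mat_pow A m $ i $ j)"
proof (induction m arbitrary: i)
  case (Suc m)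
  show ?case
    by (simp add: matrix_matrix_mult_def) (intro continuous_intros Suc)
qed simp

lemma tendsto_mat_fun:
  fixes A :: "'b \<Rightarrow> complex ^ 'n::finite ^ 'n"
  assumes f: "f holomorphic_on UNIV" and A: "(A \<longlongrightarrow> A0) L"
  shows "((\<lambda>x. mat_fun f (A x)) \<longlongrightarrow> mat_fun f A0) L"
proof -
  \<comment> \<open>One unit beyond \<open>norm A0\<close>, so that \<open>ball 0 B\<close> is a
    neighbourhood of \<open>A0\<close> on which the Weierstrass test applies with one
    majorant.\<close>
  define B where "B = norm A0 + 1"
  have "continuous_on (ball 0 B) (\<lambda>A. suminf (\<lambda>m. (deriv ^^ m) f 0 / fact m * mat_pow A m $ i $ j))" for i j :: 'n
  proof (rule uniform_limit_theorem)
    have "norm (A $ i $ j) \<le> B" if "A \<in> ball 0 B" for A :: "complex ^ 'n ^ 'n" and i j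
      using Finite_Cartesian_Product.norm_nth_le[of A i] Finite_Cartesian_Product.norm_nth_le[of "A $ i" j] that by simp
    from mat_fun_bound[OF this]
    show "uniform_limit (ball 0 B) (\<lambda>n A. \<Sum>m<n. (deriv ^^ m) f 0 / fact m * mat_pow A m $ i $ j)
       (\<lambda>A. suminf (\<lambda>m. (deriv ^^ m) f 0 / fact m * mat_pow A m $ i $ j)) sequentially"
      by (intro Weierstrass_m_test[OF _ entire_taylor_summable[OF f, of "of_nat CARD('n) * B"]]) auto
  qed (auto intro!: always_eventually continuous_intros continuous_on_mat_pow)
  hence "isCont (\<lambda>A. suminf (\<lambda>m. (deriv ^^ m) f 0 / fact m * mat_pow A m $ i $ j)) A0" for i j :: 'n
    by (auto simp: continuous_on_eq_continuous_at B_def)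
  from isCont_tendsto_compose[OF this A] show ?thesis
    unfolding mat_fun_def by (intro tendsto_vec_lambda) auto
qed

text \<open>This is \<open>exp(H(A))\<close>, in the form in which the variation produces it: one
  summand \<open>A F(A)\<close> for each of the two factors \<open>E\<close>, with \<open>A\<close>
  exposed on the left.\<close>

definition form_factor_matrix :: "(complex \<Rightarrow> complex) \<Rightarrow> complex ^ 'n::finite ^ 'n \<Rightarrow> complex ^ 'n ^ 'n" where
  "form_factor_matrix F A = mat 1 + (A ** mat_fun F A + A ** mat_fun F A)"

text \<open>The functional calculus is additive and multiplicative, so the scalar identity
  \<open>(1 + 2 z F(z)) exp(-H(z)) = 1\<close> passes to matrices.\<close>

lemma form_factor_matrix_inverse:
  fixes A :: "complex ^ 'n::finite ^ 'n"
  assumes "form_factor H F"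
  shows "form_factor_matrix F A ** mat_fun (\<lambda>z. exp (- H z)) A = mat 1"
proof -
  have H: "H holomorphic_on UNIV" and F: "F holomorphic_on UNIV" and HF: "2 * z * F z = exp (H z) - 1" for z
    using assms by (auto simp: form_factor_def)
  have eq: "(1 + (z * F z + z * F z)) * exp (- H z) = 1" for z
  proof -
    have "1 + (z * F z + z * F z) = exp (H z)" using HF[of z] by (simp add: algebra_simps)
    thus ?thesis by (simp flip: exp_add)
  qed
  have i: "(\<lambda>z. z) holomorphic_on UNIV" by (rule holomorphic_intros)
  have 1: "mat_fun (\<lambda>_. 1) A = mat 1" by (simp add: mat_fun_const vec_eq_iff)
  have "form_factor_matrix F A = mat_fun (\<lambda>z. 1 + (z * F z + z * F z)) A"
    unfolding form_factor_matrix_def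
    by (subst mat_fun_add mat_fun_mult[OF i F] | intro holomorphic_intros F)+ (simp add: 1 mat_fun_ident)
  also have "\<dots> ** mat_fun (\<lambda>z. exp (- H z)) A = mat_fun (\<lambda>z. (1 + (z * F z + z * F z)) * exp (- H z)) A"
    by (rule mat_fun_mult[symmetric]) (intro holomorphic_intros F H)+
  finally show ?thesis by (simp only: eq 1)
qed

section \<open>Derivations, substitutions and momentum\<close>

lemma mps_coeff_deriv: "mps_coeff (mps_deriv v f) M = of_nat (count M v + 1) * mps_coeff f (add_mset v M)"
  by (simp add: mps_deriv_def)

lemma mps_coeff_Sum: "mps_coeff (mps_Sum f) M = Sum_any (\<lambda>k. mps_coeff (f k) M)"
  by (simp add: mps_Sum_def)

lemma mps_deriv_add: "mps_deriv v (f + g) = mps_deriv v f + mps_deriv v g"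
  by (rule mps_eqI) (simp add: mps_coeff_deriv distrib_left)

lemma mps_deriv_0: "mps_deriv v 0 = 0"
  by (rule mps_eqI) (simp add: mps_coeff_deriv)

lemma mps_deriv_const: "mps_deriv v (mps_const c) = 0"
  by (rule mps_eqI) (simp add: mps_coeff_deriv)

lemma mps_deriv_sum: "mps_deriv v (sum f S) = (\<Sum>x\<in>S. mps_deriv v (f x))"
  by (induction S rule: infinite_finite_induct) (simp_all add: mps_deriv_0 mps_deriv_add)

lemma mps_deriv_commute: "mps_deriv v (mps_deriv w f) = mps_deriv w (mps_deriv v f)"
  by (rule mps_eqI) (simp add: mps_coeff_deriv add_mset_commute)

text \<open>Differentiation multiplies a coefficient by a nonzero integer and so preserves the
  support of the family; for infinite support both sides take the default value 0.\<close>

lemma mps_deriv_Sum: "mps_deriv v (mps_Sum f) = mps_Sum (\<lambda>k. mps_deriv v (f k))"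
proof (rule mps_eqI)
  fix M
  let ?c = "of_nat (count M v + 1) :: complex"
  have c: "?c \<noteq> 0" by (simp only: of_nat_eq_0_iff)
  let ?g = "\<lambda>k. mps_coeff (f k) (add_mset v M)"
  have eq: "{k. ?c * ?g k \<noteq> 0} = {k. ?g k \<noteq> 0}" using c by simp
  have "?c * Sum_any ?g = Sum_any (\<lambda>k. ?c * ?g k)"
    unfolding Sum_any.expand_set eq by (rule sum_distrib_left)
  thus "mps_coeff (mps_deriv v (mps_Sum f)) M = mps_coeff (mps_Sum (\<lambda>k. mps_deriv v (f k))) M"
    by (simp only: mps_coeff_deriv mps_coeff_Sum)
qed

lemma sum_submultisets_add_mset:
  fixes h :: "'v multiset \<Rightarrow> 'a::comm_semiring_1"
  shows "(\<Sum>A | A \<subseteq># add_mset v M. of_nat (count A v) * h A)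
       = (\<Sum>A | A \<subseteq># M. of_nat (count A v + 1) * h (add_mset v A))"
proof -
  have "(\<Sum>A | A \<subseteq># add_mset v M. of_nat (count A v) * h A)
      = (\<Sum>A | A \<subseteq># add_mset v M \<and> v \<in># A. of_nat (count A v) * h A)"
    by (rule sum.mono_neutral_right) (auto simp: finite_submultisets not_in_iff)
  also have "\<dots> = (\<Sum>A | A \<subseteq># M. of_nat (count (add_mset v A) v) * h (add_mset v A))"
    by (rule sum.reindex_bij_witness[where i = "add_mset v" and j = "\<lambda>A. A - {#v#}"])
       (auto simp: subset_eq_diff_conv)
  finally show ?thesis by simp
qed

text \<open>The multiplicity of \<open>v\<close> in \<open>add_mset v M\<close> is split into its
  multiplicities in \<open>A\<close> and in the complement. Each half is then a sum weighted by
  \<open>count A v\<close>, the second after passing to complements, and only submultisets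
  containing \<open>v\<close> count.\<close>

lemma mps_deriv_mult: "mps_deriv v (f * g) = mps_deriv v f * g + f * mps_deriv v g"
proof (rule mps_eqI)
  fix M
  let ?P = "{A. A \<subseteq># add_mset v M}"
  let ?h = "\<lambda>A. mps_coeff f A * mps_coeff g (add_mset v M - A)"
  have cnt: "of_nat (count M v + 1) = (of_nat (count A v) + of_nat (count (add_mset v M - A) v) :: complex)" if "A \<in> ?P" for A
  proof -
    from that have "count A v \<le> count (add_mset v M) v" by (intro mset_subset_eq_count) simp
    thus ?thesis by (simp flip: of_nat_add)
  qed
  have "mps_coeff (mps_deriv v (f * g)) M = (\<Sum>A\<in>?P. of_nat (count M v + 1) * ?h A)"
    by (simp only: mps_coeff_deriv mps_coeff_mult sum_distrib_left)
  also have "\<dots> = (\<Sum>A\<in>?P. of_nat (count A v) * ?h A) + (\<Sum>A\<in>?P. of_nat (count (add_mset v M - A) v) * ?h A)"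
    unfolding sum.distrib[symmetric] by (rule sum.cong[OF refl]) (simp only: cnt distrib_right)
  also have "(\<Sum>A\<in>?P. of_nat (count (add_mset v M - A) v) * ?h A)
      = (\<Sum>A\<in>?P. of_nat (count A v) * ?h (add_mset v M - A))"
    by (rule sum.reindex_bij_witness[where i = "\<lambda>A. add_mset v M - A" and j = "\<lambda>A. add_mset v M - A"])
       (auto simp: subset_mset.diff_diff_right)
  also have "(\<Sum>A\<in>?P. of_nat (count A v) * ?h A)
      = (\<Sum>A | A \<subseteq># M. of_nat (count A v + 1) * ?h (add_mset v A))"
    by (rule sum_submultisets_add_mset)
  also have "\<dots> = mps_coeff (mps_deriv v f * g) M"
    by (simp add: mps_coeff_mult mps_coeff_deriv mult.assoc)
  also have "(\<Sum>A\<in>?P. of_nat (count A v) * ?h (add_mset v M - A))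
      = (\<Sum>A | A \<subseteq># M. of_nat (count A v + 1) * ?h (add_mset v M - add_mset v A))"
    by (rule sum_submultisets_add_mset)
  also have "\<dots> = (\<Sum>A | A \<subseteq># M. of_nat (count (M - A) v + 1) * ?h (add_mset v M - add_mset v (M - A)))"
    by (rule sum.reindex_bij_witness[where i = "\<lambda>A. M - A" and j = "\<lambda>A. M - A"])
       (auto simp: subset_mset.diff_diff_right)
  also have "\<dots> = mps_coeff (f * mps_deriv v g) M"
    unfolding mps_coeff_mult
  proof (rule sum.cong[OF refl])
    fix A assume "A \<in> {A. A \<subseteq># M}"
    then obtain B where "M = A + B" by (auto simp: mset_subset_eq_exists_conv)
    thus "of_nat (count (M - A) v + 1) * ?h (add_mset v M - add_mset v (M - A))
        = mps_coeff f A * mps_coeff (mps_deriv v g) (M - A)"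
      by (simp add: mps_coeff_deriv)
  qed
  finally show "mps_coeff (mps_deriv v (f * g)) M = mps_coeff (mps_deriv v f * g + f * mps_deriv v g) M"
    by simp
qed

text \<open>The condition under which \<open>mps_Sum\<close> is a genuine sum, since
  \<open>Sum_any\<close> returns 0 when infinitely many terms are nonzero.\<close>

definition locally_finite :: "('k \<Rightarrow> 'v mps) \<Rightarrow> bool" where
  "locally_finite h \<longleftrightarrow> (\<forall>M. finite {k. mps_coeff (h k) M \<noteq> 0})"

lemma locally_finite_deriv: "locally_finite h \<Longrightarrow> locally_finite (\<lambda>k. mps_deriv v (h k))"
  unfolding locally_finite_def mps_coeff_deriv by simp

section \<open>Lowest-order coefficients of products\<close>

lemma mps_coeff_mult_nonzeroE:
  assumes "mps_coeff (f * g) M \<noteq> 0"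
  obtains A where "A \<subseteq># M" "mps_coeff f A \<noteq> 0" "mps_coeff g (M - A) \<noteq> 0"
proof -
  from assms obtain A where "A \<in> {A. A \<subseteq># M}" "mps_coeff f A * mps_coeff g (M - A) \<noteq> 0"
    unfolding mps_coeff_mult by (metis (no_types, lifting) sum.neutral)
  thus ?thesis using that by auto
qed

text \<open>Order is measured by proper submultisets and not by degree, because the induction over
  legs gives vanishing only at proper subsets of the current set.\<close>

definition vanishes_below :: "'v multiset \<Rightarrow> 'v mps \<Rightarrow> bool" where
  "vanishes_below M f \<longleftrightarrow> (\<forall>C. C \<subset># M \<longrightarrow> mps_coeff f C = 0)"

lemma vanishes_below_mult:
  assumes "vanishes_below M g"
  shows "vanishes_below M (f * g)"
  unfolding vanishes_below_def
proof (intro allI impI, rule ccontr)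
  fix C assume "C \<subset># M" "mps_coeff (f * g) C \<noteq> 0"
  then obtain A where "mps_coeff g (C - A) \<noteq> 0" by (elim mps_coeff_mult_nonzeroE)
  moreover have "C - A \<subset># M"
    using \<open>C \<subset># M\<close> by (meson diff_subset_eq_self subset_mset.le_less_trans)
  ultimately show False using assms by (auto simp: vanishes_below_def)
qed

text \<open>A splitting of \<open>M\<close> that gives \<open>f\<close> a nonempty part leaves
  \<open>g\<close> a proper submultiset, so only the constant term of \<open>f\<close>
  contributes.\<close>

lemma mps_coeff_mult_lowest:
  assumes "vanishes_below M g"
  shows "mps_coeff (f * g) M = mps_coeff f {#} * mps_coeff g M"
proof -
  have "mps_coeff (f * g) M = (\<Sum>A | A \<subseteq># M. if A = {#} then mps_coeff f {#} * mps_coeff g M else 0)"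
    unfolding mps_coeff_mult
  proof (rule sum.cong[OF refl])
    fix A assume "A \<in> {A. A \<subseteq># M}"
    hence "M - A \<subset># M" if "A \<noteq> {#}" using that
      by (auto simp: mset_subset_eq_exists_conv subset_mset.less_le)
    thus "mps_coeff f A * mps_coeff g (M - A) = (if A = {#} then mps_coeff f {#} * mps_coeff g M else 0)"
      using assms by (auto simp: vanishes_below_def)
  qed
  thus ?thesis by (simp add: finite_submultisets)
qed

text \<open>For nonempty \<open>M\<close> the empty multiset lies below \<open>M\<close>, so
  \<open>f\<close> has no constant term either. This discards every term with two factors
  \<open>E\<close>.\<close>

lemma mps_coeff_mult_lowest_zero:
  assumes "vanishes_below M f" "vanishes_below M g" "M \<noteq> {#}"
  shows "mps_coeff (f * g) M = 0"
  using assms mps_coeff_mult_lowest[of M g f] by (auto simp: vanishes_below_def subset_mset.less_le)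

text \<open>
  Both the substitution of a field configuration and the identity have the following properties;
  the first yields perturbative solutions, the second the kinetic matrix.
\<close>

definition functional_hom :: "('v mps \<Rightarrow> 'w mps) \<Rightarrow> bool" where
  "functional_hom \<sigma> \<longleftrightarrow> (\<forall>f g. \<sigma> (f + g) = \<sigma> f + \<sigma> g) \<and> (\<forall>f g. \<sigma> (f * g) = \<sigma> f * \<sigma> g) \<and>
     (\<forall>f. mps_coeff (\<sigma> f) {#} = mps_coeff f {#}) \<and>
     (\<forall>h :: 'v \<times> 'v \<Rightarrow> 'v mps. locally_finite h \<longrightarrow> \<sigma> (mps_Sum h) = mps_Sum (\<lambda>k. \<sigma> (h k))) \<and>
     (\<forall>h :: 'v \<times> 'v \<times> 'v \<Rightarrow> 'v mps. locally_finite h \<longrightarrow> \<sigma> (mps_Sum h) = mps_Sum (\<lambda>k. \<sigma> (h k)))"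

lemma functional_hom_id: "functional_hom (\<lambda>f. f)"
  by (simp add: functional_hom_def)

lemma functional_hom_sum:
  assumes "functional_hom \<sigma>"
  shows "\<sigma> (sum f S) = (\<Sum>x\<in>S. \<sigma> (f x))"
proof -
  have "\<sigma> (0 + 0) = \<sigma> 0 + \<sigma> 0" using assms unfolding functional_hom_def by blast
  hence "\<sigma> 0 = 0" by simp
  thus ?thesis using assms
    by (induction S rule: infinite_finite_induct) (simp_all add: functional_hom_def)
qed

text \<open>Both conditions serve to make \<open>mps_subst\<close> a finite sum in each coefficient:
  the first bounds the degree of the contributing monomials, the second leaves finitely many
  variables.\<close>

locale substitution =
  fixes \<Phi> :: "'v \<Rightarrow> 'w mps"
  assumes no_const: "mps_coeff (\<Phi> a) {#} = 0"
    and finite_fields: "finite {a. mps_coeff (\<Phi> a) C \<noteq> 0}"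
begin

abbreviation monomial :: "'v multiset \<Rightarrow> 'w mps" where
  "monomial N \<equiv> \<Prod>a\<in>#N. \<Phi> a"

definition window :: "'w multiset \<Rightarrow> 'v multiset set" where
  "window M = {N. size N \<le> size M \<and> set_mset N \<subseteq> {a. \<exists>C. C \<subseteq># M \<and> mps_coeff (\<Phi> a) C \<noteq> 0}}"

lemma window_mono: "C \<subseteq># M \<Longrightarrow> window C \<subseteq> window M"
  unfolding window_def using size_mset_mono[of C M] by (blast intro: subset_mset.order_trans order_trans)

lemma finite_window: "finite (window M)"
proof -
  have "{a. \<exists>C. C \<subseteq># M \<and> mps_coeff (\<Phi> a) C \<noteq> 0} = (\<Union>C\<in>{C. C \<subseteq># M}. {a. mps_coeff (\<Phi> a) C \<noteq> 0})"
    by auto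
  hence f: "finite {a. \<exists>C. C \<subseteq># M \<and> mps_coeff (\<Phi> a) C \<noteq> 0}" (is "finite ?X")
    by (simp only:) (rule finite_UN_I[OF finite_submultisets finite_fields])
  have "window M \<subseteq> mset ` {xs. set xs \<subseteq> ?X \<and> length xs \<le> size M}"
  proof
    fix N assume N: "N \<in> window M"
    obtain xs where "mset xs = N" using ex_mset by blast
    with N show "N \<in> mset ` {xs. set xs \<subseteq> ?X \<and> length xs \<le> size M}"
      by (auto simp: window_def intro!: image_eqI[of _ _ xs] simp flip: set_mset_mset size_mset)
  qed
  thus ?thesis using finite_lists_length_le[OF f] finite_surj by blast
qed

text \<open>A contribution at \<open>M\<close> distributes \<open>M\<close> over the factors of the
  monomial, and each factor takes a nonempty part because it has no constant term.\<close>

lemma monomial_outside_window: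
  assumes "mps_coeff (monomial N) M \<noteq> 0"
  shows "N \<in> window M"
  using assms
proof (induction N arbitrary: M)
  case empty
  then show ?case by (simp add: window_def)
next
  case (add a N)
  then obtain A where A: "A \<subseteq># M" "mps_coeff (\<Phi> a) A \<noteq> 0" "mps_coeff (monomial N) (M - A) \<noteq> 0"
    by (auto elim: mps_coeff_mult_nonzeroE)
  hence N: "N \<in> window (M - A)" using add.IH by blast
  have "size A > 0" using A(2) no_const by (cases "A = {#}") (auto simp: nonempty_has_size)
  moreover have "size M = size A + size (M - A)"
    using A(1) by (metis size_union subset_mset.add_diff_inverse)
  ultimately have "size (add_mset a N) \<le> size M" using N by (simp add: window_def)
  thus ?case using N A(1,2) window_mono[of "M - A" M] by (auto simp: window_def)
qed

text \<open>Any finite superset of the window is allowed, so that the coefficients at all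
  submultisets of \<open>M\<close> can be summed over the one range \<open>window M\<close>.\<close>

lemma coeff_subst:
  assumes "finite X" "window M \<subseteq> X"
  shows "mps_coeff (mps_subst f \<Phi>) M = (\<Sum>N\<in>X. mps_coeff f N * mps_coeff (monomial N) M)"
proof -
  have c: "mps_coeff (mps_const c * g) M = c * mps_coeff g M" for c and g :: "'w mps"
  proof -
    have "mps_coeff (mps_const c * g) M = (\<Sum>A | A \<subseteq># M. if A = {#} then c * mps_coeff g M else 0)"
      unfolding mps_coeff_mult by (rule sum.cong) auto
    thus ?thesis by (simp add: finite_submultisets)
  qed
  show ?thesis
    unfolding mps_subst_def mps_coeff_Sum c
    by (rule Sum_any.expand_superset) (use assms monomial_outside_window in auto)
qed

lemma functional_hom_subst: "functional_hom (\<lambda>f. mps_subst f \<Phi>)"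
  unfolding functional_hom_def
proof (intro conjI allI impI)
  fix f g :: "'v mps"
  show "mps_subst (f + g) \<Phi> = mps_subst f \<Phi> + mps_subst g \<Phi>"
    by (rule mps_eqI) (simp add: coeff_subst[OF finite_window order_refl] distrib_right sum.distrib)
  have "window {#} = {{#}}" by (auto simp: window_def)
  thus "mps_coeff (mps_subst f \<Phi>) {#} = mps_coeff f {#}"
    by (simp add: coeff_subst[OF finite_window order_refl])
  show "mps_subst (f * g) \<Phi> = mps_subst f \<Phi> * mps_subst g \<Phi>"
  proof (rule mps_eqI)
    fix M
    let ?W = "window M"
    let ?t = "\<lambda>A B. mps_coeff f A * mps_coeff g B * mps_coeff (monomial A * monomial B) M"
    have "mps_coeff (mps_subst (f * g) \<Phi>) M = (\<Sum>N\<in>?W. \<Sum>A | A \<subseteq># N. ?t A (N - A))"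
      unfolding coeff_subst[OF finite_window order_refl] mps_coeff_mult[of f g] sum_distrib_right
    proof (intro sum.cong refl)
      fix N A :: "'v multiset" assume "A \<in> {A. A \<subseteq># N}"
      hence "N = A + (N - A)" by simp
      hence "monomial N = monomial A * monomial (N - A)" by (metis image_mset_union prod_mset.union)
      thus "mps_coeff f A * mps_coeff g (N - A) * mps_coeff (monomial N) M = ?t A (N - A)" by simp
    qed
    also have "\<dots> = (\<Sum>(N, A)\<in>Sigma ?W (\<lambda>N. {A. A \<subseteq># N}). ?t A (N - A))"
      by (rule sum.Sigma) (auto simp: finite_window finite_submultisets)
    also have "\<dots> = (\<Sum>(A, B)\<in>{(A, B). A + B \<in> ?W}. ?t A B)"
      by (rule sum.reindex_bij_witness[where i = "\<lambda>(A, B). (A + B, A)" and j = "\<lambda>(N, A). (A, N - A)"]) auto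
    \<comment> \<open>The pairs with \<open>A + B\<close> outside the window can be added, because
      the monomial of \<open>A + B\<close> has no coefficient at \<open>M\<close>.\<close>
    also have "\<dots> = (\<Sum>(A, B)\<in>?W \<times> ?W. ?t A B)"
    proof (rule sum.mono_neutral_left)
      show "finite (?W \<times> ?W)" by (simp add: finite_window)
      show "{(A, B). A + B \<in> ?W} \<subseteq> ?W \<times> ?W" by (auto simp: window_def)
      show "\<forall>i\<in>?W \<times> ?W - {(A, B). A + B \<in> ?W}. (case i of (A, B) \<Rightarrow> ?t A B) = 0"
        using monomial_outside_window[of "_ + _" M] by (auto simp: image_mset_union)
    qed
    also have "\<dots> = (\<Sum>A\<in>?W. \<Sum>B\<in>?W. \<Sum>C | C \<subseteq># M. mps_coeff f A * mps_coeff g B *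
        (mps_coeff (monomial A) C * mps_coeff (monomial B) (M - C)))"
      by (simp add: sum.cartesian_product[symmetric] mps_coeff_mult sum_distrib_left)
    also have "\<dots> = (\<Sum>C | C \<subseteq># M. \<Sum>A\<in>?W. \<Sum>B\<in>?W. mps_coeff f A * mps_coeff g B *
        (mps_coeff (monomial A) C * mps_coeff (monomial B) (M - C)))"
      by (subst sum.swap, subst (2) sum.swap, subst sum.swap, subst (2) sum.swap) (rule refl)
    also have "\<dots> = (\<Sum>C | C \<subseteq># M. mps_coeff (mps_subst f \<Phi>) C * mps_coeff (mps_subst g \<Phi>) (M - C))"
    proof (intro sum.cong refl)
      fix C assume "C \<in> {C. C \<subseteq># M}"
      hence w: "window C \<subseteq> ?W" "window (M - C) \<subseteq> ?W" by (auto intro!: window_mono)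
      show "(\<Sum>A\<in>?W. \<Sum>B\<in>?W. mps_coeff f A * mps_coeff g B * (mps_coeff (monomial A) C * mps_coeff (monomial B) (M - C)))
          = mps_coeff (mps_subst f \<Phi>) C * mps_coeff (mps_subst g \<Phi>) (M - C)"
        unfolding coeff_subst[OF finite_window w(1)] coeff_subst[OF finite_window w(2)] sum_product
        by (simp add: mult_ac)
    qed
    finally show "mps_coeff (mps_subst (f * g) \<Phi>) M = mps_coeff (mps_subst f \<Phi> * mps_subst g \<Phi>) M"
      by (simp add: mps_coeff_mult)
  qed
  \<comment> \<open>Shown for every index type and instantiated at the end to pairs and triples, the
    indices of the quadratic and the cubic term; a definition such as \<open>functional_hom\<close>
    cannot quantify over types.\<close>
  have "mps_subst (mps_Sum h) \<Phi> = mps_Sum (\<lambda>k. mps_subst (h k) \<Phi>)" if h: "locally_finite h"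
    for h :: "'k \<Rightarrow> 'v mps"
  proof (rule mps_eqI)
    fix M
    define K where "K = (\<Union>N\<in>window M. {k. mps_coeff (h k) N \<noteq> 0})"
    have K: "finite K" using h finite_window by (auto simp: K_def locally_finite_def)
    have out: "mps_coeff (h k) N = 0" if "N \<in> window M" "k \<notin> K" for k N
      using that by (auto simp: K_def)
    have "mps_coeff (mps_subst (mps_Sum h) \<Phi>) M
        = (\<Sum>N\<in>window M. (\<Sum>k\<in>K. mps_coeff (h k) N) * mps_coeff (monomial N) M)"
      unfolding coeff_subst[OF finite_window order_refl] mps_coeff_Sum
      by (intro sum.cong refl arg_cong2[where f = "(*)"] Sum_any.expand_superset K) (use out in auto)
    also have "\<dots> = (\<Sum>k\<in>K. mps_coeff (mps_subst (h k) \<Phi>) M)"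
      unfolding coeff_subst[OF finite_window order_refl] sum_distrib_right by (rule sum.swap)
    also have "\<dots> = mps_coeff (mps_Sum (\<lambda>k. mps_subst (h k) \<Phi>)) M"
      unfolding mps_coeff_Sum
    proof (rule Sum_any.expand_superset[symmetric, OF K])
      have "mps_coeff (mps_subst (h k) \<Phi>) M = 0" if "k \<notin> K" for k
        by (simp add: coeff_subst[OF finite_window order_refl] out that)
      thus "{k. mps_coeff (mps_subst (h k) \<Phi>) M \<noteq> 0} \<subseteq> K" by blast
    qed
    finally show "mps_coeff (mps_subst (mps_Sum h) \<Phi>) M = mps_coeff (mps_Sum (\<lambda>k. mps_subst (h k) \<Phi>)) M" .
  qed
  thus "\<And>h :: 'v \<times> 'v \<Rightarrow> 'v mps. locally_finite h \<Longrightarrow> mps_subst (mps_Sum h) \<Phi> = mps_Sum (\<lambda>k. mps_subst (h k) \<Phi>)"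
    and "\<And>h :: 'v \<times> 'v \<times> 'v \<Rightarrow> 'v mps. locally_finite h \<Longrightarrow> mps_subst (mps_Sum h) \<Phi> = mps_Sum (\<lambda>k. mps_subst (h k) \<Phi>)"
    by blast+
qed

end

lemma substitution_plane_wave_field:
  fixes \<phi> :: "nat set \<Rightarrow> complex ^ 'i::finite"
  shows "substitution (plane_wave_field N p \<phi>)"
proof
  fix a and C :: "nat multiset"
  show "mps_coeff (plane_wave_field N p \<phi> a) {#} = 0"
    by (simp add: plane_wave_field_def split: prod.split)
  \<comment> \<open>The multiset \<open>C\<close> fixes the momentum of the mode, which leaves only
    the finitely many labels.\<close>
  have "{a. mps_coeff (plane_wave_field N p \<phi> a) C \<noteq> 0} \<subseteq> UNIV \<times> {\<Sum>j\<in>set_mset C. p j}"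
    by (auto simp: plane_wave_field_def split: if_splits)
  thus "finite {a. mps_coeff (plane_wave_field N p \<phi> a) C \<noteq> 0}"
    by (rule finite_subset) simp
qed

section \<open>Grading by total momentum\<close>

definition has_momentum :: "real ^ 'd::finite \<Rightarrow> ('i, 'd) functional \<Rightarrow> bool" where
  "has_momentum q f \<longleftrightarrow> (\<forall>M. mps_coeff f M \<noteq> 0 \<longrightarrow> total_momentum M = q)"

lemma total_momentum_simps [simp]:
  "total_momentum {#} = 0"
  "total_momentum (add_mset a M) = snd a + total_momentum M"
  by (simp_all add: total_momentum_def)

lemma total_momentum_diff: "A \<subseteq># M \<Longrightarrow> total_momentum (M - A) = total_momentum M - total_momentum A"
  by (auto simp: total_momentum_def mset_subset_eq_exists_conv)

lemma has_momentum_mult: "has_momentum q f \<Longrightarrow> has_momentum r g \<Longrightarrow> has_momentum (q + r) (f * g)"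
  unfolding has_momentum_def
  by (auto elim!: mps_coeff_mult_nonzeroE) (metis add_diff_cancel_left' diff_add_cancel add.commute total_momentum_diff)

lemma has_momentum_const: "has_momentum 0 (mps_const c)"
  by (simp add: has_momentum_def)

lemma has_momentum_sum: "(\<And>x. x \<in> X \<Longrightarrow> has_momentum q (f x)) \<Longrightarrow> has_momentum q (sum f X)"
  unfolding has_momentum_def by (auto) (metis (mono_tags, lifting) sum.neutral)

lemma has_momentum_Sum: "(\<And>k. has_momentum q (f k)) \<Longrightarrow> has_momentum q (mps_Sum f)"
  unfolding has_momentum_def mps_coeff_Sum by (metis Sum_any.not_neutral_obtains_not_neutral)

lemma has_momentum_deriv:
  assumes "has_momentum q f"
  shows "has_momentum (q - snd a) (mps_deriv a f)"
  using assms unfolding has_momentum_def mps_coeff_deriv by force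

text \<open>The constant term sits at the empty multiset, of momentum 0. Background operators are
  therefore diagonal in momentum, and DeWitt sums collapse to sums over labels.\<close>

lemma has_momentum_background: "has_momentum q f \<Longrightarrow> q \<noteq> 0 \<Longrightarrow> mps_coeff f {#} = 0"
  by (auto simp: has_momentum_def)

section \<open>The equations of motion to leading order in the local ones\<close>

lemma sum_fixed_momentum: "sum f (UNIV \<times> {q}) = (\<Sum>l\<in>UNIV. f (l, q))"
  by (rule sum.reindex_bij_witness[where i = "\<lambda>l. (l, q)" and j = fst]) auto

lemma Sum_any_fixed_momentum:
  fixes g :: "'i::finite \<times> (real ^ 'd::finite) \<Rightarrow> 'a::comm_monoid_add"
  assumes "\<And>c. snd c \<noteq> q \<Longrightarrow> g c = 0"
  shows "Sum_any g = (\<Sum>l\<in>UNIV. g (l, q))"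
proof -
  have "Sum_any g = sum g (UNIV \<times> {q})"
    by (rule Sum_any.expand_superset) (use assms in fastforce)+
  thus ?thesis by (simp only: sum_fixed_momentum)
qed

text \<open>The finiteness of the support is recorded because \<open>Sum_any\<close> is additive
  only for finite supports.\<close>

lemma Sum_any_fixed_momenta:
  fixes g :: "('i::finite \<times> (real ^ 'd::finite)) \<times> ('i \<times> (real ^ 'd)) \<Rightarrow> 'a::comm_monoid_add"
  assumes "\<And>a b. snd a \<noteq> q \<or> snd b \<noteq> q \<Longrightarrow> g (a, b) = 0"
  shows "finite {k. g k \<noteq> 0}" "Sum_any g = (\<Sum>l\<in>UNIV. \<Sum>k\<in>UNIV. g ((l, q), (k, q)))"
proof -
  let ?X = "UNIV \<times> {q} :: ('i \<times> (real ^ 'd)) set"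
  have sub: "{k. g k \<noteq> 0} \<subseteq> ?X \<times> ?X" using assms by fastforce
  thus "finite {k. g k \<noteq> 0}" by (rule finite_subset) simp
  have "Sum_any g = sum g (?X \<times> ?X)"
    by (rule Sum_any.expand_superset[OF _ sub]) simp
  also have "\<dots> = (\<Sum>a\<in>?X. \<Sum>b\<in>?X. g (a, b))"
    by (simp only: sum.cartesian_product) simp
  finally show "Sum_any g = (\<Sum>l\<in>UNIV. \<Sum>k\<in>UNIV. g ((l, q), (k, q)))"
    by (simp only: sum_fixed_momentum)
qed

text \<open>A finite set of DeWitt indices that can occur in the coefficient at \<open>M\<close>.
  Both signs appear because \<open>E a\<close> carries momentum \<open>- snd a\<close> and the
  raised equation carries \<open>snd a\<close>.\<close>

definition modes :: "('i::finite \<times> (real ^ 'd::finite)) multiset \<Rightarrow> ('i \<times> (real ^ 'd)) set" where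
  "modes M = {a. \<exists>C. C \<subseteq># M \<and> (snd a = total_momentum C \<or> snd a = - total_momentum C)}"

lemma finite_modes: "finite (modes M)"
proof -
  let ?P = "total_momentum ` {C. C \<subseteq># M}"
  have "modes M \<subseteq> UNIV \<times> (?P \<union> uminus ` ?P)" by (auto simp: modes_def)
  thus ?thesis by (rule finite_subset) (simp add: finite_submultisets)
qed

lemma modes_mono: "C \<subseteq># M \<Longrightarrow> modes C \<subseteq> modes M"
  unfolding modes_def by (blast intro: subset_mset.order_trans)

lemma in_modes:
  "has_momentum (snd a) f \<or> has_momentum (- snd a) f \<Longrightarrow> mps_coeff f M \<noteq> 0 \<Longrightarrow> a \<in> modes M"
  by (auto simp: has_momentum_def modes_def)

definition complex_matrix :: "real ^ 'n ^ 'm \<Rightarrow> complex ^ 'n ^ 'm" where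
  "complex_matrix A = (\<chi> i j. complex_of_real (A $ i $ j))"

text \<open>The comparison is made for a general momentum-conserving action with the background as a
  solution; gravity is put in only at the end.\<close>

locale nonlocal_theory =
  fixes \<gamma> :: "real ^ 'i::finite ^ 'i" and H F :: "complex \<Rightarrow> complex"
    and S0 V :: "('i, 'd::finite) functional"
  assumes momentum_action: "has_momentum 0 S0"
    and background: "\<And>a. mps_coeff (eom S0 a) {#} = 0"
    and field_metric: "transpose \<gamma> = \<gamma>"
    and form_factor: "form_factor H F"
    and cubic: "at_least_cubic (eom S0) V"
begin

abbreviation "E \<equiv> eom S0"
abbreviation "R \<equiv> raise_index \<gamma> (eom S0)"
abbreviation "T \<equiv> hessian_operator \<gamma> S0"
abbreviation "G \<equiv> op_apply F T"
abbreviation "S \<equiv> nonlocal_action \<gamma> F S0 V"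
text \<open>By \<open>operator_background\<close>, \<open>B (- q)\<close> is the block of the
  background Hessian operator on modes of momentum \<open>q\<close>; the sign comes from the index
  convention of \<open>kinetic\<close>.\<close>

abbreviation "B k \<equiv> kinetic S0 k ** complex_matrix \<gamma>"

definition dressing :: "real ^ 'd \<Rightarrow> complex ^ 'i ^ 'i" where
  "dressing k = form_factor_matrix F (B k)"

lemma F_entire: "F holomorphic_on UNIV"
  using form_factor by (simp add: form_factor_def)

lemma momentum_eom: "has_momentum (- snd a) (E a)"
  using has_momentum_deriv[OF momentum_action, of a] by (simp add: eom_def)

lemma momentum_hessian: "has_momentum (- snd b - snd a) (hessian S0 a b)"
  unfolding hessian_def by (intro has_momentum_deriv momentum_eom)

lemma momentum_raise_index:
  assumes "\<And>a. has_momentum (q - snd a) (X a)"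
  shows "has_momentum (q + snd a) (raise_index \<gamma> X a)"
proof (cases a)
  case (Pair i p)
  show ?thesis
    unfolding Pair raise_index_def prod.case
    using has_momentum_mult[OF has_momentum_const assms[of "(_, - p)"]]
    by (intro has_momentum_sum) simp
qed

lemma momentum_raised_eom: "has_momentum (snd a) (R a)"
  using momentum_raise_index[of 0 E a] momentum_eom by simp

lemma momentum_operator: "has_momentum (snd b - snd a) (T a b)"
proof -
  have "has_momentum (- snd a - snd c) (hessian S0 a c)" for c
    using momentum_hessian[of c a] by (simp only: diff_conv_add_uminus add.commute)
  from momentum_raise_index[OF this, of b] show ?thesis by (simp add: hessian_operator_def)
qed

lemma momentum_op_power: "has_momentum (snd b - snd a) (op_power T m a b)"
proof (induction m arbitrary: a)
  case 0
  then show ?case by (simp add: has_momentum_def)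
next
  case (Suc m)
  show ?case
    unfolding op_power.simps
  proof (rule has_momentum_Sum)
    fix c show "has_momentum (snd b - snd a) (T a c * op_power T m c b)"
    proof -
      have "has_momentum ((snd c - snd a) + (snd b - snd c)) (T a c * op_power T m c b)"
        by (intro has_momentum_mult momentum_operator Suc)
      thus ?thesis by simp
    qed
  qed
qed

lemma momentum_op_apply: "has_momentum (snd b - snd a) (op_apply f T a b)"
  unfolding has_momentum_def
proof (intro allI impI, rule ccontr)
  fix M assume "total_momentum M \<noteq> snd b - snd a" and nz: "mps_coeff (op_apply f T a b) M \<noteq> 0"
  hence "mps_coeff (op_power T m a b) M = 0" for m
    using momentum_op_power[of b a m] by (auto simp: has_momentum_def)
  with nz show False by (simp add: op_apply_def)
qed

text \<open>Second derivatives commute, and exchanging the modes \<open>(i, - k)\<close> and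
  \<open>(j, k)\<close> reverses \<open>k\<close>.\<close>

lemma transpose_kinetic: "transpose (kinetic S0 k) = kinetic S0 (- k)"
  by (simp add: vec_eq_iff transpose_def kinetic_def hessian_def eom_def mps_deriv_commute)

lemma transpose_metric: "transpose (complex_matrix \<gamma>) = complex_matrix \<gamma>"
  using field_metric by (simp add: vec_eq_iff transpose_def complex_matrix_def)

lemma operator_background:
  "mps_coeff (T (i, q) (j, r)) {#} = (if q = r then B (- q) $ i $ j else 0)"
proof (cases "q = r")
  case True
  have "\<gamma> $ j $ l = \<gamma> $ l $ j" for l
    using field_metric by (simp add: vec_eq_iff transpose_def)
  thus ?thesis using True
    by (simp add: hessian_operator_def raise_index_def matrix_matrix_mult_def kinetic_def complex_matrix_def mult.commute)
next
  case False
  thus ?thesis using has_momentum_background[OF momentum_operator, of "(j, r)" "(i, q)"] by simp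
qed

lemma op_power_background:
  "mps_coeff (op_power T m (i, q) (j, r)) {#} = (if q = r then mat_pow (B (- q)) m $ i $ j else 0)"
proof (cases "q = r")
  case True
  show ?thesis
    unfolding True
  proof (induction m arbitrary: i)
    case 0
    then show ?case by (simp add: mat_def)
  next
    case (Suc m)
    have "mps_coeff (op_power T (Suc m) (i, r) (j, r)) {#}
        = (\<Sum>l\<in>UNIV. mps_coeff (T (i, r) (l, r) * op_power T m (l, r) (j, r)) {#})"
      unfolding op_power.simps mps_coeff_Sum
      by (rule Sum_any_fixed_momentum)
         (use has_momentum_background[OF momentum_operator, of _ "(i, r)"] in auto)
    then show ?case by (simp add: Suc operator_background matrix_matrix_mult_def)
  qed
next
  case False
  thus ?thesis using has_momentum_background[OF momentum_op_power, of "(j, r)" "(i, q)"] by simp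
qed

lemma op_apply_background:
  "mps_coeff (op_apply f T (i, q) (j, r)) {#} = (if q = r then mat_fun f (B (- q)) $ i $ j else 0)"
  by (simp add: op_apply_def mat_fun_def op_power_background)

text \<open>The transpose of \<open>B (- k)\<close> is \<gamma> times the kinetic matrix at
  \<open>k\<close>, so \<gamma> intertwines it with \<open>B k\<close>, and hence also their images
  under \<open>F\<close>.\<close>

lemma form_factor_symmetry:
  "transpose (mat_fun F (B (- k))) ** complex_matrix \<gamma> = complex_matrix \<gamma> ** mat_fun F (B k)"
  unfolding transpose_mat_fun matrix_transpose_mul transpose_kinetic transpose_metric minus_minus
  by (rule mat_fun_intertwine[OF F_entire]) (simp add: matrix_mul_assoc)

lemma locally_finite_quadratic: "locally_finite (\<lambda>(a, b). R a * G a b * E b)"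
  unfolding locally_finite_def
proof
  fix M
  have "{k. mps_coeff (case k of (a, b) \<Rightarrow> R a * G a b * E b) M \<noteq> 0} \<subseteq> modes M \<times> modes M"
  proof clarify
    fix a b assume "mps_coeff (R a * G a b * E b) M \<noteq> 0"
    then obtain A where A: "A \<subseteq># M" "mps_coeff (R a * G a b) A \<noteq> 0" "mps_coeff (E b) (M - A) \<noteq> 0"
      by (rule mps_coeff_mult_nonzeroE)
    from A(2) obtain C where C: "C \<subseteq># A" "mps_coeff (R a) C \<noteq> 0"
      by (rule mps_coeff_mult_nonzeroE)
    have "a \<in> modes C" "b \<in> modes (M - A)"
      by (rule in_modes[OF _ C(2)] in_modes[OF _ A(3)]; simp add: momentum_eom momentum_raised_eom)+
    thus "a \<in> modes M \<and> b \<in> modes M"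
      using modes_mono[OF subset_mset.order_trans[OF C(1) A(1)]] modes_mono[of "M - A" M] by auto
  qed
  thus "finite {k. mps_coeff (case k of (a, b) \<Rightarrow> R a * G a b * E b) M \<noteq> 0}"
    by (rule finite_subset) (simp add: finite_modes)
qed

text \<open>Whatever \<open>W\<close> is, each of the three indices is carried by a factor
  \<open>E\<close>, whose momentum confines it to \<open>modes M\<close>.\<close>

lemma locally_finite_cubic: "locally_finite (\<lambda>(a, b, d). W a b d * E a * E b * E d)"
  unfolding locally_finite_def
proof
  fix M
  have "{k. mps_coeff (case k of (a, b, d) \<Rightarrow> W a b d * E a * E b * E d) M \<noteq> 0} \<subseteq> modes M \<times> modes M \<times> modes M"
  proof
    fix k assume "k \<in> {k. mps_coeff (case k of (a, b, d) \<Rightarrow> W a b d * E a * E b * E d) M \<noteq> 0}"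
    then obtain a b d where k: "k = (a, b, d)" and "mps_coeff (W a b d * E a * E b * E d) M \<noteq> 0"
      by (cases k) auto
    from this(2) obtain A where A: "A \<subseteq># M" "mps_coeff (W a b d * E a * E b) A \<noteq> 0" "mps_coeff (E d) (M - A) \<noteq> 0"
      by (rule mps_coeff_mult_nonzeroE)
    from A(2) obtain C where C: "C \<subseteq># A" "mps_coeff (W a b d * E a) C \<noteq> 0" "mps_coeff (E b) (A - C) \<noteq> 0"
      by (rule mps_coeff_mult_nonzeroE)
    from C(2) obtain D where D: "D \<subseteq># C" "mps_coeff (E a) (C - D) \<noteq> 0"
      by (rule mps_coeff_mult_nonzeroE)
    have m: "a \<in> modes (C - D)" "b \<in> modes (A - C)" "d \<in> modes (M - A)"
      by (rule in_modes[OF _ D(2)] in_modes[OF _ C(3)] in_modes[OF _ A(3)]; simp add: momentum_eom)+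
    have "C - D \<subseteq># M" "A - C \<subseteq># M" "M - A \<subseteq># M"
      using A(1) C(1) by (meson diff_subset_eq_self subset_mset.order_trans)+
    from this[THEN modes_mono] m
    show "k \<in> modes M \<times> modes M \<times> modes M" by (auto simp: k)
  qed
  thus "finite {k. mps_coeff (case k of (a, b, d) \<Rightarrow> W a b d * E a * E b * E d) M \<noteq> 0}"
    by (rule finite_subset) (simp add: finite_modes)
qed

text \<open>The identity in \<open>dressing\<close> comes from \<open>E\<close> itself, and the two
  copies of \<open>B F(B)\<close> come from varying the two outer factors of the quadratic term; all
  other terms contain at least two factors \<open>E\<close>.\<close>

lemma eom_leading_order:
  assumes hom: "functional_hom \<sigma>" and M: "M \<noteq> {#}"
    and van: "\<And>a. vanishes_below M (\<sigma> (E a))"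
  shows "mps_coeff (\<sigma> (eom S (i, q))) M = (\<Sum>j\<in>UNIV. dressing (- q) $ i $ j * mps_coeff (\<sigma> (E (j, q))) M)"
proof -
  let ?c = "(i, q)"
  let ?\<gamma> = "complex_matrix \<gamma>"
  define e where "e = (\<lambda>j. mps_coeff (\<sigma> (E (j, q))) M)"
  have add: "\<sigma> (f + g) = \<sigma> f + \<sigma> g" and mult: "\<sigma> (f * g) = \<sigma> f * \<sigma> g"
    and const: "mps_coeff (\<sigma> f) {#} = mps_coeff f {#}" for f g
    using hom by (auto simp: functional_hom_def)
  note lowest = mps_coeff_mult_lowest[of M] and vmult = vanishes_below_mult[of M]
  have raised: "\<sigma> (R (l, p)) = (\<Sum>j\<in>UNIV. \<sigma> (mps_const (complex_of_real (\<gamma> $ l $ j))) * \<sigma> (E (j, - p)))" for l p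
    by (simp add: raise_index_def functional_hom_sum[OF hom] mult)
  have vR: "vanishes_below M (\<sigma> (R a))" for a
    using vmult[OF van] by (cases a) (simp add: raised vanishes_below_def)
  have R: "mps_coeff (\<sigma> (R (l, p))) M = (\<Sum>j\<in>UNIV. complex_of_real (\<gamma> $ l $ j) * mps_coeff (\<sigma> (E (j, - p))) M)" for l p
    by (simp add: raised lowest[OF van] const)

  obtain W where W: "V = mps_Sum (\<lambda>(a, b, d). W a b d * E a * E b * E d)"
    using cubic by (auto simp: at_least_cubic_def)
  let ?h3 = "\<lambda>(a, b, d). W a b d * E a * E b * E d"
  let ?h2 = "\<lambda>(a, b). R a * G a b * E b"
  have eomS: "eom S ?c = E ?c + mps_Sum (\<lambda>k. mps_deriv ?c (?h2 k)) + mps_Sum (\<lambda>k. mps_deriv ?c (?h3 k))"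
    by (simp only: eom_def nonlocal_action_def mps_deriv_add W mps_deriv_Sum)
  have lf2: "locally_finite (\<lambda>k. mps_deriv ?c (?h2 k))" and lf3: "locally_finite (\<lambda>k. mps_deriv ?c (?h3 k))"
    by (intro locally_finite_deriv locally_finite_quadratic locally_finite_cubic)+
  have sum2: "\<sigma> (mps_Sum (\<lambda>k. mps_deriv ?c (?h2 k))) = mps_Sum (\<lambda>k. \<sigma> (mps_deriv ?c (?h2 k)))"
    and sum3: "\<sigma> (mps_Sum (\<lambda>k. mps_deriv ?c (?h3 k))) = mps_Sum (\<lambda>k. \<sigma> (mps_deriv ?c (?h3 k)))"
    using hom lf2 lf3 by (simp_all add: functional_hom_def)

  have "mps_coeff (\<sigma> (mps_deriv ?c (?h3 k))) M = 0" for k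
  proof -
    obtain a b d where k: "k = (a, b, d)" by (cases k)
    have "mps_deriv ?c (?h3 k) = mps_deriv ?c (W a b d * E a) * E b * E d
        + W a b d * mps_deriv ?c (E b) * E a * E d + W a b d * mps_deriv ?c (E d) * E a * E b"
      by (simp add: k mps_deriv_mult algebra_simps)
    thus ?thesis
      by (simp add: add mult mps_coeff_mult_lowest_zero[OF vmult[OF van] van M])
  qed
  hence c3: "mps_coeff (\<sigma> (mps_Sum (\<lambda>k. mps_deriv ?c (?h3 k)))) M = 0"
    by (simp add: sum3 mps_coeff_Sum)

  \<comment> \<open>\<open>t1\<close> is the variation of the left factor \<open>R a\<close> and
    \<open>t2\<close> that of the right factor \<open>E b\<close>. The variation of
    \<open>G a b\<close> keeps both and vanishes at \<open>M\<close>.\<close>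
  define t1 where "t1 = (\<lambda>(a, b). mps_coeff (T ?c a * G a b) {#} * mps_coeff (\<sigma> (E b)) M)"
  define t2 where "t2 = (\<lambda>(a, b). mps_coeff (G a b * hessian S0 ?c b) {#} * mps_coeff (\<sigma> (R a)) M)"
  have "mps_coeff (\<sigma> (mps_deriv ?c (?h2 k))) M = t1 k + t2 k" for k
  proof -
    obtain a b where k: "k = (a, b)" by (cases k)
    have "mps_deriv ?c (R a) = T ?c a"
      by (cases a) (simp add: raise_index_def hessian_operator_def hessian_def mps_deriv_sum mps_deriv_mult mps_deriv_const)
    hence "mps_deriv ?c (?h2 k) = T ?c a * G a b * E b + mps_deriv ?c (G a b) * R a * E b + G a b * hessian S0 ?c b * R a"
      by (simp add: k mps_deriv_mult hessian_def algebra_simps)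
    moreover have "mps_coeff (\<sigma> (T ?c a * G a b * E b)) M = t1 k"
      using lowest[OF van, of "\<sigma> (T ?c a * G a b)" b] by (simp only: mult t1_def k prod.case const)
         (simp add: const flip: mult)
    moreover have "mps_coeff (\<sigma> (G a b * hessian S0 ?c b * R a)) M = t2 k"
      using lowest[OF vR, of "\<sigma> (G a b * hessian S0 ?c b)" a] by (simp only: mult t2_def k prod.case const)
         (simp add: const flip: mult)
    ultimately show ?thesis
      by (simp add: add mult mps_coeff_mult_lowest_zero[OF vmult[OF vR] van M])
  qed
  hence c2: "mps_coeff (\<sigma> (mps_Sum (\<lambda>k. mps_deriv ?c (?h2 k)))) M = Sum_any (\<lambda>k. t1 k + t2 k)"
    by (simp add: sum2 mps_coeff_Sum)

  \<comment> \<open>The background value fixes both summation indices: at momentum \<open>q\<close>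
    in \<open>t1\<close>, and at \<open>- q\<close> in \<open>t2\<close>, because the Hessian with
    lower indices pairs opposite momenta.\<close>
  have T0: "mps_coeff (T ?c a) {#} = 0" if "snd a \<noteq> q" for a
    using has_momentum_background[OF momentum_operator, of a ?c] that by simp
  have G0: "mps_coeff (G a b) {#} = 0" if "snd a \<noteq> snd b" for a b
    using has_momentum_background[OF momentum_op_apply, of b a] that by simp
  have H0: "mps_coeff (hessian S0 ?c b) {#} = 0" if "snd b \<noteq> - q" for b
    using has_momentum_background[OF momentum_hessian, of b ?c] that
    by (metis add.inverse_inverse diff_eq_eq eq_iff_diff_eq_0 add_0 snd_conv)
  have s1: "t1 (a, b) = 0" if "snd a \<noteq> q \<or> snd b \<noteq> q" for a b
    using that T0[of a] G0[of a b] by (cases "snd a = q") (auto simp: t1_def)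
  have s2: "t2 (a, b) = 0" if "snd a \<noteq> - q \<or> snd b \<noteq> - q" for a b
    using that H0[of b] G0[of a b] by (cases "snd b = - q") (auto simp: t2_def)

  note fin1 = Sum_any_fixed_momenta(1)[of q t1, OF s1] and sa1 = Sum_any_fixed_momenta(2)[of q t1, OF s1]
  note fin2 = Sum_any_fixed_momenta(1)[of "- q" t2, OF s2] and sa2 = Sum_any_fixed_momenta(2)[of "- q" t2, OF s2]

  let ?B = "B (- q)"
  let ?F = "mat_fun F ?B"
  have "Sum_any t1 = (\<Sum>l\<in>UNIV. \<Sum>k\<in>UNIV. ?B $ i $ l * ?F $ l $ k * e k)"
  proof -
    have "t1 ((l, q), (k, q)) = ?B $ i $ l * ?F $ l $ k * e k" for l k
      by (simp add: t1_def operator_background op_apply_background e_def)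
    thus ?thesis by (simp only: sa1)
  qed
  also have "\<dots> = (\<Sum>k\<in>UNIV. (?B ** ?F) $ i $ k * e k)"
    by (subst sum.swap) (simp add: matrix_matrix_mult_def sum_distrib_right)
  finally have e1: "Sum_any t1 = (\<Sum>k\<in>UNIV. (?B ** ?F) $ i $ k * e k)" .

  have "Sum_any t2 = (\<Sum>l\<in>UNIV. \<Sum>k\<in>UNIV. mat_fun F (B q) $ l $ k * kinetic S0 (- q) $ i $ k * (\<Sum>j\<in>UNIV. ?\<gamma> $ l $ j * e j))"
  proof -
    have "t2 ((l, - q), (k, - q)) = mat_fun F (B q) $ l $ k * kinetic S0 (- q) $ i $ k * (\<Sum>j\<in>UNIV. ?\<gamma> $ l $ j * e j)" for l k
      by (simp add: t2_def op_apply_background R e_def kinetic_def complex_matrix_def)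
    thus ?thesis by (simp only: sa2)
  qed
  also have "\<dots> = (\<Sum>j\<in>UNIV. \<Sum>k\<in>UNIV. \<Sum>l\<in>UNIV. kinetic S0 (- q) $ i $ k * (mat_fun F (B q) $ l $ k * ?\<gamma> $ l $ j) * e j)"
  proof -
    have "(\<Sum>l\<in>UNIV. \<Sum>k\<in>UNIV. \<Sum>j\<in>UNIV. x l k j) = (\<Sum>j\<in>UNIV. \<Sum>k\<in>UNIV. \<Sum>l\<in>UNIV. x l k j)"
      for x :: "'i \<Rightarrow> 'i \<Rightarrow> 'i \<Rightarrow> complex"
    proof -
      have "(\<Sum>l\<in>UNIV. \<Sum>k\<in>UNIV. \<Sum>j\<in>UNIV. x l k j) = (\<Sum>k\<in>UNIV. \<Sum>l\<in>UNIV. \<Sum>j\<in>UNIV. x l k j)"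
        by (rule sum.swap)
      also have "\<dots> = (\<Sum>k\<in>UNIV. \<Sum>j\<in>UNIV. \<Sum>l\<in>UNIV. x l k j)"
        by (intro sum.cong refl sum.swap)
      finally show ?thesis by (subst sum.swap)
    qed
    thus ?thesis by (simp add: sum_distrib_left mult_ac)
  qed
  also have "\<dots> = (\<Sum>j\<in>UNIV. (kinetic S0 (- q) ** (transpose (mat_fun F (B q)) ** ?\<gamma>)) $ i $ j * e j)"
    by (simp add: matrix_matrix_mult_def transpose_def sum_distrib_left sum_distrib_right)
  \<comment> \<open>The symmetry of the form factor at \<open>- q\<close> turns the transposed
    expression into the contribution already found for \<open>t1\<close>.\<close>
  also have "kinetic S0 (- q) ** (transpose (mat_fun F (B q)) ** ?\<gamma>) = ?B ** ?F"
    using form_factor_symmetry[of "- q"] by (simp add: matrix_mul_assoc)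
  finally have e2: "Sum_any t2 = (\<Sum>k\<in>UNIV. (?B ** ?F) $ i $ k * e k)" .

  have "mps_coeff (\<sigma> (eom S ?c)) M = e i + (Sum_any t1 + Sum_any t2)"
    unfolding eomS add mps_coeff_simps c2 c3
    using Sum_any.distrib[OF fin1 fin2] by (simp add: e_def)
  also have "e i = (\<Sum>j\<in>UNIV. mat 1 $ i $ j * e j)"
    by (simp add: mat_def if_distrib[of "\<lambda>x. x * _"] cong: if_cong)
  finally show ?thesis
    by (simp only: e1 e2 dressing_def form_factor_matrix_def vector_add_component e_def sum.distrib distrib_right)
qed

text \<open>The linear part of an equation of motion is the kinetic matrix, so
  \<open>eom_leading_order\<close> is applied to the identity at a one-element multiset. Below it
  lies only the background equation.\<close>

lemma kinetic_nonlocal: "kinetic S k = dressing k ** kinetic S0 k"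
proof -
  have coeff: "kinetic S' k $ i $ j = mps_coeff (eom S' (i, - k)) {#(j, k)#}" for S' i j
    by (simp add: kinetic_def hessian_def eom_def mps_deriv_commute[of "(i, - k)"]) (simp add: mps_coeff_deriv)
  have "vanishes_below {#(j, k)#} (E a)" for j a
    unfolding vanishes_below_def
  proof (intro allI impI)
    fix C assume "C \<subset># {#(j, k)#}"
    from mset_subset_size[OF this] have "C = {#}" by simp
    thus "mps_coeff (E a) C = 0" by (simp add: background)
  qed
  from eom_leading_order[OF functional_hom_id _ this] show ?thesis
    by (simp add: vec_eq_iff coeff matrix_matrix_mult_def)
qed

end

section \<open>Continuity of the kinetic matrix\<close>

text \<open>Derivatives include multiplicities that coefficients miss:
  \<open>fluctuation i * fluctuation i\<close> has coefficient 2 at opposite modes but 1 where they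
  coincide at \<open>k = 0\<close>, while its second derivative there is always 2. First derivatives
  are included for the Leibniz rule.\<close>

definition regular_jet :: "('i, 'd::finite) functional \<Rightarrow> bool" where
  "regular_jet f \<longleftrightarrow>
     (\<forall>i. continuous_on UNIV (\<lambda>p. mps_coeff (mps_deriv (i, p) f) {#})) \<and>
     (\<forall>i j. continuous_on UNIV (\<lambda>k. mps_coeff (mps_deriv (i, - k) (mps_deriv (j, k) f)) {#}))"

lemma mps_coeff_deriv2_background:
  "mps_coeff (mps_deriv a (mps_deriv b f)) {#} = of_nat (count {#a#} b + 1) * mps_coeff f {#b, a#}"
  by (simp add: mps_coeff_deriv)

lemma regular_jet_cong:
  assumes "regular_jet g" and "\<And>M. size M \<le> 2 \<Longrightarrow> mps_coeff f M = mps_coeff g M"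
  shows "regular_jet f"
proof -
  have "mps_coeff (mps_deriv a f) {#} = mps_coeff (mps_deriv a g) {#}"
    and "mps_coeff (mps_deriv a (mps_deriv b f)) {#} = mps_coeff (mps_deriv a (mps_deriv b g)) {#}" for a b
    by (simp_all add: mps_coeff_deriv2_background assms(2)) (simp add: mps_coeff_deriv assms(2))
  thus ?thesis using assms(1) by (simp add: regular_jet_def)
qed

lemma regular_jet_const: "regular_jet (mps_const c)"
  by (simp add: regular_jet_def mps_deriv_const mps_deriv_0)

lemma regular_jet_fluctuation: "regular_jet (fluctuation i)"
  by (simp add: regular_jet_def mps_coeff_deriv2_background) (simp add: mps_coeff_deriv fluctuation_def)

lemma regular_jet_add: "regular_jet f \<Longrightarrow> regular_jet g \<Longrightarrow> regular_jet (f + g)"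
  by (simp add: regular_jet_def mps_deriv_add continuous_on_add)

lemma regular_jet_mult:
  assumes f: "regular_jet f" and g: "regular_jet g"
  shows "regular_jet (f * g)"
proof -
  have c: "continuous_on UNIV (\<lambda>p. mps_coeff (mps_deriv (i, p) h) {#})"
    and c2: "continuous_on UNIV (\<lambda>k. mps_coeff (mps_deriv (i, - k) (mps_deriv (j, k) h)) {#})"
    if "regular_jet h" for h :: "('a, 'b) functional" and i j
    using that by (simp_all add: regular_jet_def)
  have c': "continuous_on UNIV (\<lambda>k. mps_coeff (mps_deriv (i, - k) h) {#})"
    if "regular_jet h" for h :: "('a, 'b) functional" and i
    by (rule continuous_on_compose2[OF c[OF that]]) (auto intro: continuous_intros)
  note cs = c[OF f] c[OF g] c2[OF f] c2[OF g] c'[OF f] c'[OF g]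
  show ?thesis
    unfolding regular_jet_def mps_deriv_mult mps_deriv_add mps_coeff_simps mps_coeff_mult_0
    by (intro conjI allI continuous_on_add continuous_on_mult continuous_on_const cs)
qed

lemma regular_jet_uminus:
  fixes f :: "('i, 'd::finite) functional"
  assumes "regular_jet f"
  shows "regular_jet (- f)"
proof -
  have "mps_const (- 1) = (- 1 :: ('i, 'd) functional)" by (rule mps_eqI) simp
  hence "mps_const (- 1) * f = - f" by simp
  thus ?thesis using regular_jet_mult[OF regular_jet_const[of "- 1"] assms] by simp
qed

lemma regular_jet_diff: "regular_jet f \<Longrightarrow> regular_jet g \<Longrightarrow> regular_jet (f - g)"
  using regular_jet_add[OF _ regular_jet_uminus, of f g] by simp

lemma regular_jet_0: "regular_jet 0"
  by (simp add: regular_jet_def mps_deriv_0)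

lemma regular_jet_1: "regular_jet (1 :: ('i, 'd::finite) functional)"
proof -
  have eq: "(1 :: ('i, 'd) functional) = mps_const 1" by (rule mps_eqI) simp
  show ?thesis by (subst eq) (rule regular_jet_const)
qed

lemma regular_jet_sum: "(\<And>x. x \<in> X \<Longrightarrow> regular_jet (f x)) \<Longrightarrow> regular_jet (sum f X)"
  by (induction X rule: infinite_finite_induct) (simp_all add: regular_jet_0 regular_jet_add)

lemma regular_jet_prod: "(\<And>x. x \<in> X \<Longrightarrow> regular_jet (f x)) \<Longrightarrow> regular_jet (prod f X)"
  by (induction X rule: infinite_finite_induct) (simp_all add: regular_jet_1 regular_jet_mult)

text \<open>At first order the derivative multiplies by a function linear in the momentum. At second
  order the modes \<open>- k\<close> and \<open>k\<close> have total momentum 0, so the result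
  vanishes.\<close>

lemma regular_jet_partial:
  assumes "regular_jet f"
  shows "regular_jet (partial \<mu> f)"
proof -
  have "mps_coeff (mps_deriv (i, p) (partial \<mu> f)) {#}
      = - \<i> * complex_of_real (p $ \<mu>) * mps_coeff (mps_deriv (i, p) f) {#}" for i p
    by (simp add: mps_coeff_deriv partial_def)
  moreover have "mps_coeff (mps_deriv (i, - k) (mps_deriv (j, k) (partial \<mu> f))) {#} = 0" for i j k
    by (simp add: mps_coeff_deriv2_background partial_def)
  moreover have "continuous_on UNIV (\<lambda>p. - \<i> * complex_of_real (p $ \<mu>) * mps_coeff (mps_deriv (i, p) f) {#})" for i
    using assms by (intro continuous_intros) (simp add: regular_jet_def)
  ultimately show ?thesis
    unfolding regular_jet_def by (simp only: continuous_on_const simp_thms)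
qed

lemma regular_jet_differential_polynomials: "L \<in> differential_polynomials \<Longrightarrow> regular_jet L"
  by (induction rule: differential_polynomials.induct)
     (simp_all only: regular_jet_const regular_jet_fluctuation regular_jet_partial regular_jet_add regular_jet_mult)

lemma regular_jet_local_density:
  assumes "local_density L"
  shows "regular_jet L"
proof -
  from assms obtain L' where "L' \<in> differential_polynomials" "\<And>M. size M \<le> 2 \<Longrightarrow> mps_coeff L M = mps_coeff L' M"
    unfolding local_density_def by blast
  thus ?thesis using regular_jet_cong regular_jet_differential_polynomials by blast
qed

text \<open>Differentiating \<open>s * s = f\<close> twice on the background, where \<open>s\<close>
  is 1, expresses the jet of \<open>s\<close> as a polynomial in that of \<open>f\<close>.\<close>

lemma regular_jet_sqrt:
  assumes f: "regular_jet f" and root: "s * s = f" and s0: "mps_coeff s {#} = 1"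
  shows "regular_jet s"
proof -
  have "mps_coeff (mps_deriv a f) {#} = 2 * mps_coeff (mps_deriv a s) {#}" for a
    unfolding root[symmetric] mps_deriv_mult mps_coeff_simps mps_coeff_mult_0 s0 by simp
  hence 1: "mps_coeff (mps_deriv a s) {#} = mps_coeff (mps_deriv a f) {#} / 2" for a
    by simp
  have "mps_coeff (mps_deriv a (mps_deriv b f)) {#} = 2 * mps_coeff (mps_deriv a (mps_deriv b s)) {#}
      + 2 * mps_coeff (mps_deriv a s) {#} * mps_coeff (mps_deriv b s) {#}" for a b
    unfolding root[symmetric] mps_deriv_mult mps_deriv_add mps_coeff_simps mps_coeff_mult_0 s0 by simp
  hence 2: "mps_coeff (mps_deriv a (mps_deriv b s)) {#} = mps_coeff (mps_deriv a (mps_deriv b f)) {#} / 2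
      - mps_coeff (mps_deriv a f) {#} * mps_coeff (mps_deriv b f) {#} / 4" for a b
    unfolding 1 by (simp add: field_simps)
  have c: "continuous_on UNIV (\<lambda>p. mps_coeff (mps_deriv (i, p) f) {#})"
    and c2: "continuous_on UNIV (\<lambda>k. mps_coeff (mps_deriv (i, - k) (mps_deriv (j, k) f)) {#})" for i j
    using f by (simp_all add: regular_jet_def)
  have c': "continuous_on UNIV (\<lambda>k. mps_coeff (mps_deriv (i, - k) f) {#})" for i
    by (rule continuous_on_compose2[OF c]) (auto intro: continuous_intros)
  show ?thesis
    unfolding regular_jet_def 1 2
    by (intro conjI allI continuous_on_diff continuous_on_divide continuous_on_mult continuous_on_const c c' c2)
       simp_all
qed

lemma regular_jet_order_ge: "mps_order_ge 3 f \<Longrightarrow> regular_jet f"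
  by (rule regular_jet_cong[OF regular_jet_0]) (simp add: mps_order_ge_def)

section \<open>Jets of the gravitational densities\<close>

lemma regular_jet_metric: "regular_jet (spacetime_metric t $ \<mu> $ \<nu>)"
  by (simp add: spacetime_metric_def regular_jet_add regular_jet_const regular_jet_fluctuation)

lemma regular_jet_sqrt_abs_det: "regular_jet (sqrt_abs_det t :: ('m, 'd::finite) grav_functional)"
proof (rule regular_jet_sqrt)
  have "regular_jet (of_int (sign p) :: ('m, 'd) grav_functional)" for p :: "'d \<Rightarrow> 'd"
    by (simp add: sign_def regular_jet_1 regular_jet_uminus)
  thus "regular_jet (- det (spacetime_metric t :: ('m, 'd) grav_functional ^ 'd ^ 'd))"
    unfolding det_def
    by (intro regular_jet_uminus regular_jet_sum regular_jet_mult regular_jet_prod regular_jet_metric)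
qed (rule sqrt_abs_det_unique_root[THEN conjunct1] sqrt_abs_det_unique_root[THEN conjunct2])+

text \<open>
  With \<open>X = 1 - \<eta> g\<close> of first order in the fluctuations, \<open>g\<^sup>-\<^sup>1 = \<eta> + X g\<^sup>-\<^sup>1\<close>, hence
  \<open>g\<^sup>-\<^sup>1 = (1 + X + X\<^sup>2) \<eta> + X\<^sup>3 g\<^sup>-\<^sup>1\<close>, whose last term does not affect the jet.
\<close>

lemma regular_jet_inverse_metric:
  "regular_jet ((inverse_metric t :: ('m, 'd::finite) grav_functional ^ 'd ^ 'd) $ \<mu> $ \<nu>)"
proof -
  define g where "g = (spacetime_metric t :: ('m, 'd) grav_functional ^ 'd ^ 'd)"
  define N where "N = matrix_inv g"
  define e where "e = ((\<chi> \<mu> \<nu>. mps_const (complex_of_real (minkowski t \<mu> \<nu>))) :: ('m, 'd) grav_functional ^ 'd ^ 'd)"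
  define X where "X = mat 1 - e ** g"
  have "\<exists>A'. g ** A' = mat 1 \<and> A' ** g = mat 1"
    using invertible_spacetime_metric[of t] by (simp add: invertible_def g_def)
  hence gN: "g ** N = mat 1" unfolding N_def matrix_inv_def by (rule someI2_ex) simp
  have N: "N = e + X ** N"
    by (simp add: X_def matrix_sub_rd gN flip: matrix_mul_assoc)
  have XN: "X ** N = X ** e + X ** (X ** N)"
    by (rule trans[OF arg_cong[OF N, of "(**) X"] matrix_add_ldistrib])
  have XXN: "X ** (X ** N) = X ** (X ** e) + X ** (X ** (X ** N))"
    by (rule trans[OF arg_cong[OF XN, of "(**) X"] matrix_add_ldistrib])
  have expand: "N = e + (X ** e + (X ** (X ** e) + X ** (X ** (X ** N))))"
    by (rule trans[OF N arg_cong[OF trans[OF XN arg_cong[OF XXN, of "(+) (X ** e)"]], of "(+) e"]])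

  have mult: "regular_jet ((A ** C) $ \<mu> $ \<nu>)" if "\<And>\<mu> \<nu>. regular_jet (A $ \<mu> $ \<nu>)" "\<And>\<mu> \<nu>. regular_jet (C $ \<mu> $ \<nu>)"
    for A C :: "('m, 'd) grav_functional ^ 'd ^ 'd" and \<mu> \<nu>
    unfolding matrix_matrix_mult_def vec_lambda_beta by (intro regular_jet_sum regular_jet_mult that)
  have e: "regular_jet (e $ \<mu> $ \<nu>)" for \<mu> \<nu>
    by (simp add: e_def regular_jet_const)
  have X: "regular_jet (X $ \<mu> $ \<nu>)" for \<mu> \<nu>
  proof -
    have "regular_jet ((mat 1 :: ('m, 'd) grav_functional ^ 'd ^ 'd) $ \<mu> $ \<nu>)"
      by (simp add: mat_def regular_jet_1 regular_jet_0)
    thus ?thesis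
      unfolding X_def vector_minus_component by (intro regular_jet_diff mult e) (simp_all add: g_def regular_jet_metric)
  qed
  have X1: "mps_order_ge (Suc 0) (X $ \<mu> $ \<nu>)" for \<mu> \<nu>
  proof -
    have "mps_coeff ((e ** g) $ \<mu> $ \<nu>) {#} = (\<Sum>\<rho>\<in>UNIV. if \<rho> = \<mu> then if \<mu> = \<nu> then 1 else 0 else 0)"
      unfolding matrix_matrix_mult_def vec_lambda_beta mps_coeff_sum mps_coeff_mult_0
      by (rule sum.cong) (auto simp: e_def g_def spacetime_metric_def minkowski_def fluctuation_def)
    thus ?thesis by (simp add: mps_order_ge_1 X_def mat_def)
  qed
  have order: "mps_order_ge (Suc n) ((X ** A) $ \<mu> $ \<nu>)" if "\<And>\<mu> \<nu>. mps_order_ge n (A $ \<mu> $ \<nu>)"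
    for n and A :: "('m, 'd) grav_functional ^ 'd ^ 'd" and \<mu> \<nu>
    using mps_order_ge_mult[OF X1 that] by (simp add: matrix_matrix_mult_def mps_order_ge_sum)
  have "mps_order_ge 3 ((X ** (X ** (X ** N))) $ \<mu> $ \<nu>)"
    unfolding numeral_3_eq_3 by (intro order mps_order_ge_0)
  hence "regular_jet ((X ** (X ** (X ** N))) $ \<mu> $ \<nu>)"
    by (rule regular_jet_order_ge)
  moreover have "regular_jet (e $ \<mu> $ \<nu>)" "regular_jet ((X ** e) $ \<mu> $ \<nu>)" "regular_jet ((X ** (X ** e)) $ \<mu> $ \<nu>)"
    by (intro mult X e)+
  ultimately have "regular_jet ((e + (X ** e + (X ** (X ** e) + X ** (X ** (X ** N))))) $ \<mu> $ \<nu>)"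
    by (simp only: vector_add_component regular_jet_add)
  hence "regular_jet (N $ \<mu> $ \<nu>)"
    by (simp only: expand[symmetric])
  thus ?thesis by (simp add: N_def inverse_metric_def g_def)
qed

lemma regular_jet_ricci_scalar: "regular_jet (ricci_scalar t :: ('m, 'd::finite) grav_functional)"
proof -
  have "regular_jet (christoffel t \<rho> \<mu> \<nu> :: ('m, 'd) grav_functional)" for \<rho> \<mu> \<nu>
    unfolding christoffel_def
    by (intro regular_jet_mult regular_jet_sum regular_jet_const regular_jet_inverse_metric regular_jet_add
        regular_jet_diff regular_jet_partial regular_jet_metric)
  hence "regular_jet (ricci t \<mu> \<nu> :: ('m, 'd) grav_functional)" for \<mu> \<nu>
    unfolding ricci_def
    by (intro regular_jet_mult regular_jet_sum regular_jet_add regular_jet_diff regular_jet_partial)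
  thus ?thesis
    unfolding ricci_scalar_def by (intro regular_jet_sum regular_jet_mult regular_jet_inverse_metric)
qed

lemma continuous_kinetic_spacetime_integral:
  assumes "regular_jet L"
  shows "continuous_on UNIV (\<lambda>k. kinetic (spacetime_integral L) k $ i $ j)"
proof -
  have "kinetic (spacetime_integral L) k $ i $ j = mps_coeff (mps_deriv (i, - k) (mps_deriv (j, k) L)) {#}" for k
    by (simp add: kinetic_def hessian_def eom_def mps_coeff_deriv2_background spacetime_integral_def)
  thus ?thesis using assms by (simp add: regular_jet_def)
qed

lemma continuous_kinetic_local_action:
  "local_density Lm \<Longrightarrow> continuous_on UNIV (\<lambda>k. kinetic (local_action t \<kappa> Lm) k $ i $ j)"
  unfolding local_action_def
  by (intro continuous_kinetic_spacetime_integral regular_jet_mult regular_jet_add regular_jet_const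
      regular_jet_sqrt_abs_det regular_jet_ricci_scalar regular_jet_local_density)

lemma momentum_local_action: "has_momentum 0 (local_action t \<kappa> Lm)"
  by (simp add: has_momentum_def local_action_def spacetime_integral_def)

section \<open>Perturbative solutions and amplitudes\<close>

lemma tendsto_matrix_vector_mult:
  fixes A :: "'b \<Rightarrow> complex ^ 'n::finite ^ 'm::finite"
  shows "(A \<longlongrightarrow> a) L \<Longrightarrow> (v \<longlongrightarrow> b) L \<Longrightarrow> ((\<lambda>x. A x *v v x) \<longlongrightarrow> a *v b) L"
  unfolding matrix_vector_mult_def by (intro tendsto_vec_lambda tendsto_sum tendsto_mult tendsto_vec_nth)

lemma sum_mult_matrix_vector_mult:
  "(\<Sum>i\<in>UNIV. u $ i * (A *v J) $ i) = (\<Sum>j\<in>UNIV. (u v* A) $ j * J $ j)" for A :: "complex ^ 'n::finite ^ 'n"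
  unfolding matrix_vector_mult_def vector_matrix_mult_def vec_lambda_beta sum_distrib_left sum_distrib_right
  by (subst sum.swap) (simp add: mult_ac)

lemma matrix_inv_matrix_inv:
  fixes A :: "complex ^ 'n::finite ^ 'n"
  assumes "invertible A"
  shows "matrix_inv (matrix_inv A) = A"
proof -
  have inv: "B ** matrix_inv B = mat 1 \<and> matrix_inv B ** B = mat 1" if "invertible B" for B :: "complex ^ 'n ^ 'n"
    using that unfolding invertible_def matrix_inv_def by (rule someI_ex)
  have "invertible (matrix_inv A)" using inv[OF assms] by (auto simp: invertible_def)
  from inv[OF this] inv[OF assms] show ?thesis
    by (metis matrix_mul_assoc matrix_mul_lid matrix_mul_rid)
qed

text \<open>Links the order on multisets used in \<open>vanishes_below\<close> with inclusion of
  sets of legs.\<close>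

lemma submultiset_mset_set:
  assumes "finite P" "C \<subseteq># mset_set P"
  shows "C = mset_set (set_mset C)"
proof (rule multiset_eqI)
  fix x
  have "count C x \<le> count (mset_set P) x" using assms(2) by (rule mset_subset_eq_count)
  also have "\<dots> \<le> 1" using assms(1) by (simp add: count_mset_set')
  finally have "count C x \<le> 1" .
  moreover have "0 < count C x \<longleftrightarrow> x \<in># C" by simp
  ultimately show "count C x = count (mset_set (set_mset C)) x"
    unfolding count_mset_set' by (simp only: finite_set_mset simp_thms split: if_split) linarith
qed

text \<open>
  The gauge-fixing term drops out of the amputation, since the solution obeys the gauge condition.
\<close>

lemma has_tree_amplitude_kinetic:
  assumes "n \<ge> 3"
  shows "has_tree_amplitude t S Q n m legs A \<longleftrightarrow>
     (let limit = at legs within generic_legs t S Q (n - 1) m in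
      limit \<noteq> bot \<and>
      (\<exists>\<phi> J. (\<forall>\<^sub>F l in limit. perturbative_solution S Q (n - 1) l (\<phi> l)) \<and>
         ((\<lambda>l. kinetic S (\<Sum>j<n - 1. fst (l j)) *v ((1 / \<i>) *s \<phi> l {..<n - 1})) \<longlongrightarrow> J) limit \<and>
         A = (\<Sum>i\<in>UNIV. snd (legs (n - 1)) $ i * J $ i)))"
proof -
  define limit where "limit = at legs within generic_legs t S Q (n - 1) m"
  have eq: "((\<lambda>l. (1 / \<i>) *s (matrix_inv (green S Q (\<Sum>j<n - 1. fst (l j))) *v \<phi> l {..<n - 1})) \<longlongrightarrow> J) limit
      \<longleftrightarrow> ((\<lambda>l. kinetic S (\<Sum>j<n - 1. fst (l j)) *v ((1 / \<i>) *s \<phi> l {..<n - 1})) \<longlongrightarrow> J) limit"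
    if sol: "\<forall>\<^sub>F l in limit. perturbative_solution S Q (n - 1) l (\<phi> l)" for \<phi> J
  proof (rule tendsto_cong)
    have "\<forall>\<^sub>F l in limit. l \<in> generic_legs t S Q (n - 1) m"
      unfolding limit_def by (simp add: eventually_at_filter)
    with sol show "\<forall>\<^sub>F l in limit. (1 / \<i>) *s (matrix_inv (green S Q (\<Sum>j<n - 1. fst (l j))) *v \<phi> l {..<n - 1})
        = kinetic S (\<Sum>j<n - 1. fst (l j)) *v ((1 / \<i>) *s \<phi> l {..<n - 1})"
    proof eventually_elim
      case (elim l)
      let ?k = "\<Sum>j<n - 1. fst (l j)"
      \<comment> \<open>Since \<open>n \<ge> 3\<close>, the sources form a set of at least two legs,
        so genericity keeps \<open>?k\<close> away from the poles.\<close>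
      have "off_shell S Q ?k" using elim(2) assms unfolding generic_legs_def by auto
      hence "matrix_inv (green S Q ?k) = kinetic S ?k + Q ?k"
        by (simp add: off_shell_def green_def matrix_inv_matrix_inv)
      moreover have "{..<n - 1} \<noteq> {}" using assms by (simp add: lessThan_empty_iff)
      hence "Q ?k *v \<phi> l {..<n - 1} = 0"
        using elim(1) unfolding perturbative_solution_def by blast
      ultimately show ?case by (simp only: matrix_vector_mult_add_rdistrib vector_scalar_commute add_0_right)
    qed
  qed
  show ?thesis
    unfolding has_tree_amplitude_def Let_def limit_def[symmetric] using eq by blast
qed

section \<open>Comparison of the solutions and amplitudes of the two theories\<close>

context nonlocal_theory
begin

text \<open>An entire function of \<open>B k\<close> in place of an abstract inverse, so that
  \<open>tendsto_mat_fun\<close> gives its limit.\<close>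

definition dressing_inv :: "real ^ 'd \<Rightarrow> complex ^ 'i ^ 'i" where
  "dressing_inv k = mat_fun (\<lambda>z. exp (- H z)) (B k)"

lemma dressing_inverse: "dressing k ** dressing_inv k = mat 1" "dressing_inv k ** dressing k = mat 1"
proof -
  show "dressing k ** dressing_inv k = mat 1"
    unfolding dressing_def dressing_inv_def by (rule form_factor_matrix_inverse[OF form_factor])
  thus "dressing_inv k ** dressing k = mat 1" by (simp add: matrix_left_right_inverse)
qed

lemma dressing_mult_eq_0_iff: "dressing k *v v = 0 \<longleftrightarrow> v = 0"
proof
  assume "dressing k *v v = 0"
  hence "dressing_inv k *v (dressing k *v v) = 0" by simp
  thus "v = 0" by (simp add: matrix_vector_mul_assoc dressing_inverse)
qed simp

lemma kinetic_nonlocal_mult_eq_0_iff: "kinetic S k *v v = 0 \<longleftrightarrow> kinetic S0 k *v v = 0"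
  by (simp add: kinetic_nonlocal dressing_mult_eq_0_iff flip: matrix_vector_mul_assoc)

text \<open>At lowest order the two equations differ by the invertible \<open>dressing\<close>.
  Local solutions satisfy the lowest-order condition at once; conversely, induction over proper
  subsets supplies it, and invertibility gives the local equation at \<open>P\<close>.\<close>

lemma plane_wave_solves_iff:
  fixes \<sigma> :: "('i, 'd) functional \<Rightarrow> nat mps"
  assumes hom: "functional_hom \<sigma>"
  shows "(\<forall>P\<subseteq>{..<N}. P \<noteq> {} \<longrightarrow> (\<forall>a. mps_coeff (\<sigma> (eom S a)) (mset_set P) = 0)) \<longleftrightarrow>
    (\<forall>P\<subseteq>{..<N}. P \<noteq> {} \<longrightarrow> (\<forall>a. mps_coeff (\<sigma> (E a)) (mset_set P) = 0))"
proof -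
  have leading: "mps_coeff (\<sigma> (eom S (i, q))) (mset_set P) = (dressing (- q) *v (\<chi> j. mps_coeff (\<sigma> (E (j, q))) (mset_set P))) $ i"
    if P: "P \<subseteq> {..<N}" "P \<noteq> {}" and below: "\<And>P' a. P' \<subset> P \<Longrightarrow> P' \<noteq> {} \<Longrightarrow> mps_coeff (\<sigma> (E a)) (mset_set P') = 0"
    for P i q
  proof -
    have fin: "finite P" using P(1) finite_subset by blast
    have "vanishes_below (mset_set P) (\<sigma> (E a))" for a
      unfolding vanishes_below_def
    proof (intro allI impI)
      fix C assume C: "C \<subset># mset_set P"
      hence eq: "C = mset_set (set_mset C)"
        using submultiset_mset_set[OF fin] by (simp add: subset_mset.less_imp_le)
      show "mps_coeff (\<sigma> (E a)) C = 0"
      \<comment> \<open>The empty multiset is no set of legs covered by \<open>below\<close>; there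
        the background equation applies.\<close>
      proof (cases "C = {#}")
        case True
        thus ?thesis using hom background by (simp add: functional_hom_def)
      next
        case False
        have "set_mset C \<subseteq> P" using C fin set_mset_mono[of C "mset_set P"] by (simp add: subset_mset.less_imp_le)
        moreover have "set_mset C \<noteq> P" using C eq by auto
        ultimately have "set_mset C \<subset> P" by blast
        from below[OF this, of a] False show ?thesis by (simp flip: eq)
      qed
    qed
    moreover have "mset_set P \<noteq> {#}" using P(2) fin by (simp add: mset_set_empty_iff)
    ultimately show ?thesis
      using eom_leading_order[OF hom, of "mset_set P" i q] by (simp add: matrix_vector_mult_def)
  qed
  show ?thesis
  proof
    assume loc: "\<forall>P\<subseteq>{..<N}. P \<noteq> {} \<longrightarrow> (\<forall>a. mps_coeff (\<sigma> (E a)) (mset_set P) = 0)"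
    show "\<forall>P\<subseteq>{..<N}. P \<noteq> {} \<longrightarrow> (\<forall>a. mps_coeff (\<sigma> (eom S a)) (mset_set P) = 0)"
    proof (intro allI impI)
      fix P :: "nat set" and a :: "'i \<times> (real ^ 'd)" assume P: "P \<subseteq> {..<N}" "P \<noteq> {}"
      obtain i q where a: "a = (i, q)" by (cases a)
      have "mps_coeff (\<sigma> (E a)) (mset_set P') = 0" if "P' \<subset> P" "P' \<noteq> {}" for P' a
        using loc that P(1) by (meson psubset_imp_subset order_trans)
      from leading[OF P this] loc P show "mps_coeff (\<sigma> (eom S a)) (mset_set P) = 0"
        by (simp add: a matrix_vector_mult_def)
    qed
  next
    assume nonloc: "\<forall>P\<subseteq>{..<N}. P \<noteq> {} \<longrightarrow> (\<forall>a. mps_coeff (\<sigma> (eom S a)) (mset_set P) = 0)"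
    have "P \<subseteq> {..<N} \<Longrightarrow> P \<noteq> {} \<Longrightarrow> mps_coeff (\<sigma> (E a)) (mset_set P) = 0" if "finite P" for P a
      using that
    proof (induction P arbitrary: a rule: finite_psubset_induct)
      case (psubset P)
      obtain i q where a: "a = (i, q)" by (cases a)
      have below: "mps_coeff (\<sigma> (E a)) (mset_set P') = 0" if "P' \<subset> P" "P' \<noteq> {}" for P' a
        using psubset.IH[OF that(1)] that psubset.prems(1) by auto
      have "dressing (- q) *v (\<chi> j. mps_coeff (\<sigma> (E (j, q))) (mset_set P)) = 0"
        unfolding vec_eq_iff
        using leading[OF psubset.prems below, of _ q] nonloc psubset.prems by simp
      hence "(\<chi> j. mps_coeff (\<sigma> (E (j, q))) (mset_set P)) $ i = 0 $ i"
        unfolding dressing_mult_eq_0_iff by simp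
      thus ?case by (simp add: a)
    qed
    thus "\<forall>P\<subseteq>{..<N}. P \<noteq> {} \<longrightarrow> (\<forall>a. mps_coeff (\<sigma> (E a)) (mset_set P) = 0)"
      using finite_subset[OF _ finite_lessThan] by blast
  qed
qed

lemma perturbative_solution_iff:
  assumes "\<And>k v. Q k *v v = 0 \<longleftrightarrow> Q0 k *v v = 0"
  shows "perturbative_solution S Q N legs \<phi> \<longleftrightarrow> perturbative_solution S0 Q0 N legs \<phi>"
  unfolding perturbative_solution_def assms imp_conjR all_conj_distrib
  by (simp only: plane_wave_solves_iff[OF substitution.functional_hom_subst[OF substitution_plane_wave_field]])

text \<open>With \<open>gauge_fixing\<close>, being off shell means that the kinetic matrix and the
  gauge condition have no common kernel. These kernels agree in the two theories.\<close>

lemma generic_legs_eq: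
  assumes gauge: "gauge_fixing S0 Q0" "gauge_fixing S Q"
    and ker: "\<And>k v. Q k *v v = 0 \<longleftrightarrow> Q0 k *v v = 0"
  shows "generic_legs t S Q N m = generic_legs t S0 Q0 N m"
proof -
  have off: "off_shell S' Q' k \<longleftrightarrow> (\<forall>v. kinetic S' k *v v = 0 \<and> Q' k *v v = 0 \<longrightarrow> v = 0)"
    if "gauge_fixing S' Q'" for S' Q' and k :: "real ^ 'd"
  proof
    assume "off_shell S' Q' k"
    then obtain C where C: "C ** (kinetic S' k + Q' k) = mat 1"
      by (auto simp: off_shell_def invertible_def)
    show "\<forall>v. kinetic S' k *v v = 0 \<and> Q' k *v v = 0 \<longrightarrow> v = 0"
    proof (intro allI impI)
      fix v assume "kinetic S' k *v v = 0 \<and> Q' k *v v = 0"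
      hence "(kinetic S' k + Q' k) *v v = 0" by (simp add: matrix_vector_mult_add_rdistrib)
      hence "C *v ((kinetic S' k + Q' k) *v v) = 0" by simp
      thus "v = 0" by (simp add: matrix_vector_mul_assoc C)
    qed
  next
    assume "\<forall>v. kinetic S' k *v v = 0 \<and> Q' k *v v = 0 \<longrightarrow> v = 0"
    with that show "off_shell S' Q' k" unfolding gauge_fixing_def off_shell_def by blast
  qed
  show ?thesis
    unfolding generic_legs_def on_shell_def off[OF gauge(1)] off[OF gauge(2)] ker kinetic_nonlocal_mult_eq_0_iff
    by (rule refl)
qed

text \<open>This is \<open>e^H = 1\<close> on the mass shell. By \<open>transpose_kinetic\<close>,
  the free equation for \<open>u\<close> says that \<open>u\<close> annihilates the kinetic matrix
  at \<open>- p\<close> from the left, and \<open>B (- p)\<close> stands leftmost in everything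
  beyond the identity.\<close>

lemma polarisation_mult_dressing:
  assumes "kinetic S0 p *v u = 0"
  shows "u v* dressing (- p) = u" "u v* dressing_inv (- p) = u"
proof -
  have "u v* kinetic S0 (- p) = 0"
    using assms by (simp flip: transpose_kinetic)
  hence "u v* (kinetic S0 (- p) ** C) = 0" for C
    by (simp flip: vector_matrix_mul_assoc)
  from this[of "complex_matrix \<gamma> ** _"] have zero: "u v* (B (- p) ** C) = 0" for C
    by (simp add: matrix_mul_assoc)
  show dressing: "u v* dressing (- p) = u"
    unfolding dressing_def form_factor_matrix_def vector_matrix_mult_add_rdistrib zero by simp
  show "u v* dressing_inv (- p) = u"
    by (subst (1) dressing[symmetric]) (simp add: vector_matrix_mul_assoc dressing_inverse)
qed

theorem tree_amplitude_iff:
  assumes gauge: "gauge_fixing S0 Q0" "gauge_fixing S Q"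
    and ker: "\<And>k v. Q k *v v = 0 \<longleftrightarrow> Q0 k *v v = 0"
    and cont: "\<And>i j. continuous_on UNIV (\<lambda>k. kinetic S0 k $ i $ j)"
    and n: "n \<ge> 3"
    and on_shell: "on_shell t S0 Q0 (m (n - 1)) (legs (n - 1))"
    and conservation: "(\<Sum>j<n. fst (legs j)) = 0"
  shows "has_tree_amplitude t S Q n m legs A \<longleftrightarrow> has_tree_amplitude t S0 Q0 n m legs A"
proof -
  define limit where "limit = at legs within generic_legs t S0 Q0 (n - 1) m"
  define p where "p = fst (legs (n - 1))"
  define u where "u = snd (legs (n - 1))"
  define k where "k = (\<lambda>l :: nat \<Rightarrow> (real ^ 'd) \<times> (complex ^ 'i). \<Sum>j<n - 1. fst (l j))"
  have "k legs + p = 0"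
    using conservation n unfolding k_def p_def by (cases n) auto
  hence "k legs = - p" by (simp add: eq_neg_iff_add_eq_0)
  \<comment> \<open>Configurations of legs carry the product topology, so convergence is
    coordinatewise.\<close>
  moreover have "((\<lambda>l. l j) \<longlongrightarrow> legs j) limit" for j
  proof -
    have "((\<lambda>l. l j) \<longlongrightarrow> legs j) (at legs)"
    proof -
      have "continuous_on UNIV (\<lambda>l :: nat \<Rightarrow> (real ^ 'd) \<times> (complex ^ 'i). l j)"
        by (rule continuous_on_product_coordinates)
      thus ?thesis by (simp add: continuous_on_def)
    qed
    thus ?thesis unfolding limit_def by (rule tendsto_within_subset) simp
  qed
  hence "(k \<longlongrightarrow> k legs) limit"
    unfolding k_def by (intro tendsto_sum tendsto_fst)
  ultimately have k: "(k \<longlongrightarrow> - p) limit" by simp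
  have "((\<lambda>l. kinetic S0 (k l)) \<longlongrightarrow> kinetic S0 (- p)) limit"
  proof (intro vec_tendstoI)
    fix i j
    have "isCont (\<lambda>k. kinetic S0 k $ i $ j) (- p)"
      using cont[of i j] by (simp add: continuous_on_eq_continuous_at)
    thus "((\<lambda>l. kinetic S0 (k l) $ i $ j) \<longlongrightarrow> kinetic S0 (- p) $ i $ j) limit"
      using k by (rule isCont_tendsto_compose)
  qed
  hence B: "((\<lambda>l. B (k l)) \<longlongrightarrow> B (- p)) limit"
    unfolding matrix_matrix_mult_def by (intro tendsto_intros tendsto_vec_lambda tendsto_vec_nth)
  have dressing: "((\<lambda>l. dressing (k l)) \<longlongrightarrow> dressing (- p)) limit"
  proof -
    have "((\<lambda>l. B (k l) ** mat_fun F (B (k l))) \<longlongrightarrow> B (- p) ** mat_fun F (B (- p))) limit"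
      using B tendsto_mat_fun[OF F_entire B] unfolding matrix_matrix_mult_def[of "B _" "mat_fun _ _"]
      by (intro tendsto_vec_lambda tendsto_sum tendsto_mult tendsto_vec_nth)
    thus ?thesis unfolding dressing_def form_factor_matrix_def by (intro tendsto_intros)
  qed
  have dressing_inv: "((\<lambda>l. dressing_inv (k l)) \<longlongrightarrow> dressing_inv (- p)) limit"
    unfolding dressing_inv_def using form_factor
    by (intro tendsto_mat_fun B) (auto simp: form_factor_def intro!: holomorphic_intros)
  have u: "kinetic S0 p *v u = 0"
    using on_shell by (simp add: on_shell_def p_def u_def case_prod_unfold)

  \<comment> \<open>The amputated limits \<open>J\<close> and \<open>J'\<close> may differ, but only
    by the factor \<open>C (- p)\<close>, which the contraction with \<open>u\<close> does not see.
    Both directions follow, with \<open>dressing\<close> and with \<open>dressing_inv\<close> as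
    \<open>C\<close>.\<close>
  have transfer: "\<exists>J'. ((\<lambda>l. K' (k l) *v v l) \<longlongrightarrow> J') limit \<and> (\<Sum>i\<in>UNIV. u $ i * J $ i) = (\<Sum>i\<in>UNIV. u $ i * J' $ i)"
    if J: "((\<lambda>l. K (k l) *v v l) \<longlongrightarrow> J) limit" and C: "((\<lambda>l. C (k l)) \<longlongrightarrow> C (- p)) limit"
      and K': "\<And>q. K' q = C q ** K q" and uC: "u v* C (- p) = u"
    for K K' C :: "real ^ 'd \<Rightarrow> complex ^ 'i ^ 'i" and v J
  proof (intro exI conjI)
    show "((\<lambda>l. K' (k l) *v v l) \<longlongrightarrow> C (- p) *v J) limit"
      using tendsto_matrix_vector_mult[OF C J] by (simp add: K' matrix_vector_mul_assoc)
    show "(\<Sum>i\<in>UNIV. u $ i * J $ i) = (\<Sum>i\<in>UNIV. u $ i * (C (- p) *v J) $ i)"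
      by (simp add: sum_mult_matrix_vector_mult uC)
  qed
  have S0_eq: "kinetic S0 q = dressing_inv q ** kinetic S q" for q
    by (simp add: kinetic_nonlocal matrix_mul_assoc dressing_inverse)
  have limits: "(\<exists>J. ((\<lambda>l. kinetic S (k l) *v v l) \<longlongrightarrow> J) limit \<and> A = (\<Sum>i\<in>UNIV. u $ i * J $ i)) \<longleftrightarrow>
      (\<exists>J. ((\<lambda>l. kinetic S0 (k l) *v v l) \<longlongrightarrow> J) limit \<and> A = (\<Sum>i\<in>UNIV. u $ i * J $ i))" for v
  proof
    assume "\<exists>J. ((\<lambda>l. kinetic S (k l) *v v l) \<longlongrightarrow> J) limit \<and> A = (\<Sum>i\<in>UNIV. u $ i * J $ i)"
    then obtain J where "((\<lambda>l. kinetic S (k l) *v v l) \<longlongrightarrow> J) limit" "A = (\<Sum>i\<in>UNIV. u $ i * J $ i)" by blast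
    with transfer[OF this(1) dressing_inv S0_eq polarisation_mult_dressing(2)[OF u]]
    show "\<exists>J. ((\<lambda>l. kinetic S0 (k l) *v v l) \<longlongrightarrow> J) limit \<and> A = (\<Sum>i\<in>UNIV. u $ i * J $ i)" by simp
  next
    assume "\<exists>J. ((\<lambda>l. kinetic S0 (k l) *v v l) \<longlongrightarrow> J) limit \<and> A = (\<Sum>i\<in>UNIV. u $ i * J $ i)"
    then obtain J where "((\<lambda>l. kinetic S0 (k l) *v v l) \<longlongrightarrow> J) limit" "A = (\<Sum>i\<in>UNIV. u $ i * J $ i)" by blast
    with transfer[OF this(1) dressing kinetic_nonlocal polarisation_mult_dressing(1)[OF u]]
    show "\<exists>J. ((\<lambda>l. kinetic S (k l) *v v l) \<longlongrightarrow> J) limit \<and> A = (\<Sum>i\<in>UNIV. u $ i * J $ i)" by simp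
  qed
  have fold: "(\<Sum>j<n - 1. fst (l j)) = k l" for l by (simp only: k_def)
  show ?thesis
    unfolding has_tree_amplitude_kinetic[OF n] Let_def generic_legs_eq[OF gauge ker] limit_def[symmetric]
      perturbative_solution_iff[OF ker] fold u_def[symmetric]
    by (simp only: ex_simps limits)
qed

end

theorem theorem1:
  fixes t :: "'d::finite"
    and \<kappa> :: real
    and Lm V S_loc S :: "('m::finite, 'd) grav_functional"
    and \<gamma> :: "real ^ ('d uprod + 'm) ^ ('d uprod + 'm)"
    and H F :: "complex \<Rightarrow> complex"
    and Q_loc Q :: "real ^ 'd \<Rightarrow> complex ^ ('d uprod + 'm) ^ ('d uprod + 'm)"
    and n :: nat
    and m :: "nat \<Rightarrow> real"
    and legs :: "nat \<Rightarrow> (real ^ 'd) \<times> (complex ^ ('d uprod + 'm))"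
    and A :: complex
  assumes "\<kappa> > 0"
    and "local_density Lm"
    and S_loc: "S_loc = local_action t \<kappa> Lm"
    and background: "\<And>a. mps_coeff (eom S_loc a) {#} = 0"
    and field_metric: "transpose \<gamma> = \<gamma>" "invertible \<gamma>"
    and form_factor: "form_factor H F"
    and "translation_invariant V"
    and "at_least_cubic (eom S_loc) V"
    and S: "S = nonlocal_action \<gamma> F S_loc V"
    and gauge: "gauge_fixing S_loc Q_loc" "gauge_fixing S Q"
      "\<And>k v. Q k *v v = 0 \<longleftrightarrow> Q_loc k *v v = 0"
    and "n \<ge> 3"
    and on_shell: "\<And>j. j < n \<Longrightarrow> on_shell t S_loc Q_loc (m j) (legs j)"
    and momentum_conservation: "(\<Sum>j<n. fst (legs j)) = 0"
  shows "has_tree_amplitude t S Q n m legs A \<longleftrightarrow> has_tree_amplitude t S_loc Q_loc n m legs A"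
proof -
  \<comment> \<open>Of the gravitational action the comparison uses momentum conservation here and
    continuity of the kinetic matrix below.\<close>
  interpret nonlocal_theory \<gamma> H F S_loc V
  proof
    show "has_momentum 0 S_loc"
      unfolding S_loc by (rule momentum_local_action)
  qed (fact background field_metric(1) form_factor \<open>at_least_cubic (eom S_loc) V\<close>)+
  show ?thesis
    unfolding S
  proof (rule tree_amplitude_iff)
    show "continuous_on UNIV (\<lambda>k. kinetic S_loc k $ i $ j)" for i j
      unfolding S_loc using \<open>local_density Lm\<close> by (rule continuous_kinetic_local_action)
    show "on_shell t S_loc Q_loc (m (n - 1)) (legs (n - 1))"
      using on_shell[of "n - 1"] \<open>n \<ge> 3\<close> by simp
    show "gauge_fixing (nonlocal_action \<gamma> F S_loc V) Q"
      using gauge(2) by (simp only: S)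
  qed (fact gauge(1) gauge(3) \<open>n \<ge> 3\<close> momentum_conservation)+
qed

end
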